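(* Let $\mathsf{sep}\ge 1$, $m\ge 2$ and $n$ be integers such that $n\ge 2(m+\mathsf{sep}-1)$. Let $C\in\mathbb{C}^{n\times n}$ satisfy $$DC-CD=\widetilde G\widetilde H^*,\qquad D=\mathrm{diag}(\omega^0,\omega^2,\ldots,\omega^{2n-2}),\quad \omega=\exp(\mathrm{i}\pi/n),$$ with $\mathrm{rank}(\widetilde G\widetilde H^* )\le\rho$, and let $C_{JK}$ be an $(m,\mathsf{sep})$ submatrix of $C$. Then, for every $0<\epsilon<1$, $$\mathrm{rank}_\epsilon(C_{JK})\le \rho\left\lceil \frac{2}{\pi^2}\log\left(4\,\frac{m+\mathsf{sep}-1}{\mathsf{sep}}\right)\log\left(\frac{4}{\epsilon}\right)\right\rceil .$$
   Context: Matrix rows and columns are indexed from $0$ to $n-1$. For nonempty $J,K\subset\{0,\ldots,n-1\}$, $C_{JK}$ denotes the $|J|\times|K|$ submatrix of $C$ containing all entries $c_{jk}$ with $j\in J$, $k\in K$. $(m,\mathsf{sep})$ submatrix: given integers $m\ge1$, $\mathsf{sep}\ge1$, $C_{JK}$ is called an $(m,\mathsf{sep})$ submatrix of $C$ if (i) $\max\{|k-k'|: k,k'\in K\}\le m-1$; (ii) $\min\{|j-k|: j\in J,k\in K\}\ge\mathsf{sep}$; (iii) $|j-k-n|\ge\mathsf{sep}$ and $|j-k+n|\ge\mathsf{sep}$ for all $j\in J$, $k\in K$; (iv) no element of $J$ lies in the integer interval $[\min K,\max K]$ (so that $\{\omega^{2j}:j\in J\}$ and $\{\omega^{2k}:k\in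 K\}$ are contained in disjoint arcs of the unit circle). $\epsilon$-rank: for a matrix $X$ with singular values $\sigma_1(X)\ge\sigma_2(X)\ge\cdots\ge 0$ (with $\sigma_i(X)=0$ for $i$ larger than the smaller dimension of $X$) and $0<\epsilon<1$, $\mathrm{rank}_\epsilon(X)$ is the smallest integer $k\ge0$ such that $\sigma_{k+1}(X)\le\epsilon\|X\|_2$, where $\|X\|_2=\sigma_1(X)$ is the spectral norm. $\log$ is the natural logarithm. *)

theory Defs
  imports
    Complex_Main
    "Jordan_Normal_Form.Char_Poly"
    "Jordan_Normal_Form.Schur_Decomposition"
    "Jordan_Normal_Form.DL_Rank"
    "Jordan_Normal_Form.DL_Submatrix"
begin

(* Index sets J, K of an (m, sep) submatrix of an n x n matrix with indices 0, ..., n - 1.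
   The distances are taken in the integers, since subtraction of naturals truncates. *)
definition m_sep_indices :: "nat \<Rightarrow> nat \<Rightarrow> nat \<Rightarrow> nat set \<Rightarrow> nat set \<Rightarrow> bool" where
  "m_sep_indices n m sep J K \<longleftrightarrow>
     J \<noteq> {} \<and> K \<noteq> {} \<and> J \<subseteq> {0..<n} \<and> K \<subseteq> {0..<n} \<and>
     (\<forall>k\<in>K. \<forall>k'\<in>K. \<bar>int k - int k'\<bar> \<le> int m - 1) \<and>
     (\<forall>j\<in>J. \<forall>k\<in>K. \<bar>int j - int k\<bar> \<ge> int sep) \<and>
     (\<forall>j\<in>J. \<forall>k\<in>K. \<bar>int j - int k - int n\<bar> \<ge> int sep \<and> \<bar>int j - int k + int n\<bar> \<ge> int sep) \<and>
     (\<forall>j\<in>J. j \<notin> {Min K..Max K})"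

(* The square roots of the eigenvalues of X^* X, with algebraic multiplicity, in decreasing
   order. These eigenvalues are real and nonnegative, so taking Re loses nothing. *)
definition singular_value_list :: "complex mat \<Rightarrow> real list" where
  "singular_value_list X =
     rev (sorted_list_of_multiset
       (image_mset (\<lambda>z. sqrt (Re z)) (proots (char_poly (mat_adjoint X * X)))))"

(* Numbered from 1; the value at 0 is a dummy. *)
definition singular_value :: "complex mat \<Rightarrow> nat \<Rightarrow> real" where
  "singular_value X i =
     (if 1 \<le> i \<and> i \<le> min (dim_row X) (dim_col X) then singular_value_list X ! (i - 1) else 0)"

definition spectral_norm :: "complex mat \<Rightarrow> real" where
  "spectral_norm X = singular_value X 1"

definition eps_rank :: "real \<Rightarrow> complex mat \<Rightarrow> nat" where
  "eps_rank \<epsilon> X = (LEAST k. singular_value X (k + 1) \<le> \<epsilon> * spectral_norm X)"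

end

(* Write x = M (omega^(2j)) for a Moebius map M that sends the nodes indexed by K into [1/b, b]
   and those indexed by J into [-b, -1/b], b = 2 (m + sep - 1) / sep. The displacement equation
   then says that (x_j - x_k) C_jk has rank at most rho, so replacing C_jk by
   C_jk (1 - R(x_k) / R(x_j)) with R(x) = prod_{i<k} (x - y_i) / (x + y_i) gives a matrix of rank
   at most rho k whose distance from C_JK is at most (max_[1/b,b] |R|)^2 times the norm.

   The nodes y_i of Zolotarev's problem come from theta functions. With Gaussian sums D and N
   (N with alternating signs) and X the quotient of the odd and the even part of a Gaussian sum,
   rearranging the double series gives
     S(u + v) S(u - v) = (X(u) - X(v)) / (X(u) + X(v)),   S = N / D.
   By the q-binomial theorem |S| is the product of |tanh ((u - jT) / 2)| over all integers j, so
   for y_i = X((i + 1/2) T / (2k)) the function R(X(u)) is, up to sign and translation, S with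
   period T / (2k). Its maximum f satisfies f(T)^2 <= 2 f(T/2) (Landen), and iterating this down
   to T -> 0, where log f(T) is compared with -(4/T) sum_j (2j+1)^(-2), yields
   f(T) <= 2 exp (-pi^2 / (2T)). *)

theory Submission
  imports "HOL-Analysis.Analysis" Defs
begin

unbundle no vec_syntax

section \<open>Theta series\<close>

text \<open>The symmetry R(-x) = 1 / R(x) lets one bound of |R| on [1/b, b] serve the rows and the
  columns, so its square appears. The constants of the theorem then arise as follows. The least
  value of X is at most 2 exp (-T/4), hence T = 4 ln (2 b) puts [1/b, b] into the range of X. With
  period s = T / (2k) the bound f(s) <= 2 exp (-pi^2 / (2s)) gives |R|^2 <= 4 exp (-2 pi^2 k / T),
  which is at most epsilon exactly when k >= (2 / pi^2) ln (2 b) ln (4 / epsilon). The factor 2 in b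
  = 2 M, M = (m + sep - 1) / sep, comes from the Moebius map: its distortion involves square roots
  of tangents, and (p + q)^2 <= 2 (p^2 + q^2) trades these for a ratio of angles. The exponent pi^2
  / (2T) belongs to the other side of the modular transformation of theta functions. Halving T
  reaches it with real series alone, because T (ln f(T) - ln 2) never decreases when T is
  halved.\<close>

lemma summable_on_exp_minus_abs_int: "(\<lambda>p::int. exp (- \<bar>real_of_int p\<bar>)) summable_on UNIV"
proof -
  have "(\<lambda>n. exp (-1::real) ^ n) summable_on UNIV"
    by (subst summable_on_UNIV_nonneg_real_iff) (auto intro!: summable_geometric)
  hence *: "(\<lambda>n::nat. exp (- real n)) summable_on UNIV"
    by (simp flip: exp_of_nat_mult)
  have 1: "(\<lambda>p::int. exp (- \<bar>real_of_int p\<bar>)) summable_on range int"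
    by (subst summable_on_reindex) (use * in \<open>auto simp: o_def\<close>)
  have 2: "(\<lambda>p::int. exp (- \<bar>real_of_int p\<bar>)) summable_on range (\<lambda>n. - int n)"
    by (subst summable_on_reindex) (use * in \<open>auto simp: o_def inj_on_def\<close>)
  have "UNIV = range int \<union> range (\<lambda>n. - int n)"
    by (auto simp: image_iff) (metis int_cases2)
  thus ?thesis using summable_on_union[OF 1 2] by simp
qed

lemma has_sum_mult_Times:
  fixes f :: "'a \<Rightarrow> real" and g :: "'b \<Rightarrow> real"
  assumes "f summable_on A" "g summable_on B"
  shows "((\<lambda>(x,y). f x * g y) has_sum (infsum f A * infsum g B)) (A \<times> B)"
proof -
  have fa: "(\<lambda>x. \<bar>f x\<bar>) summable_on A" and ga: "(\<lambda>x. \<bar>g x\<bar>) summable_on B"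
    using assms summable_on_iff_abs_summable_on_real by force+
  have "(\<lambda>(x,y). \<bar>f x\<bar> * \<bar>g y\<bar>) summable_on Sigma A (\<lambda>_. B)"
  proof (rule summable_on_SigmaI)
    show "((\<lambda>y. case (x, y) of (x, y) \<Rightarrow> \<bar>f x\<bar> * \<bar>g y\<bar>) has_sum (\<bar>f x\<bar> *
        infsum (\<lambda>y. \<bar>g y\<bar>) B)) B" for x
      using ga by (auto intro!: has_sum_cmult_right)
    show "(\<lambda>x. \<bar>f x\<bar> * infsum (\<lambda>y. \<bar>g y\<bar>) B) summable_on A"
      using fa by (rule summable_on_cmult_left)
  qed auto
  hence s: "(\<lambda>(x,y). f x * g y) summable_on A \<times> B"
    by (subst summable_on_iff_abs_summable_on_real) (simp add: case_prod_unfold abs_mult)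
  show ?thesis
  proof (rule has_sum_SigmaI[OF _ _ s])
    show "((\<lambda>y. case (x, y) of (x, y) \<Rightarrow> f x * g y) has_sum (f x * infsum g B)) B" for x
      using assms by (auto intro!: has_sum_cmult_right)
    show "((\<lambda>x. f x * infsum g B) has_sum infsum f A * infsum g B) A"
      using assms by (auto intro!: has_sum_cmult_left)
  qed
qed

section \<open>Gaussian series, their convergence and their product formulas\<close>

text \<open>In classical notation, with nome exp (-T) and the imaginary argument -iu, the even
  indices sum to theta_3 and the odd ones to theta_2. The imaginary argument keeps every term real
  and positive.\<close>

definition gauss_term :: "real \<Rightarrow> real \<Rightarrow> int \<Rightarrow> real" where
  "gauss_term T u p = exp (of_int p * u - T * (of_int p)\<^sup>2 / 4)"

definition theta_even :: "real \<Rightarrow> real \<Rightarrow> real" where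
  "theta_even T u = infsum (gauss_term T u) {p. even p}"

definition theta_odd :: "real \<Rightarrow> real \<Rightarrow> real" where
  "theta_odd T u = infsum (gauss_term T u) {p. odd p}"

text \<open>The terms of theta_2 with nome exp (-T/2) at -iw/2. With alternating signs they sum to
  theta_1 up to a factor i, so \<open>theta_num\<close> vanishes at w = 0.\<close>

definition half_term :: "real \<Rightarrow> real \<Rightarrow> int \<Rightarrow> real" where
  "half_term T w a = exp ((of_int a + 1/2) * w - T / 2 * (of_int a + 1/2)\<^sup>2)"

definition theta_den :: "real \<Rightarrow> real \<Rightarrow> real" where
  "theta_den T w = infsum (half_term T w) UNIV"

definition theta_num :: "real \<Rightarrow> real \<Rightarrow> real" where
  "theta_num T w = infsum (\<lambda>a. (if even a then 1 else -1) * half_term T w a) UNIV"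

lemma gauss_term_pos: "gauss_term T u p > 0"
  by (simp add: gauss_term_def)

lemma half_term_pos: "half_term T u p > 0"
  by (simp add: half_term_def)

lemma gauss_term_summable: assumes "T > 0" shows "gauss_term T u summable_on A"
proof -
  have bound: "norm (gauss_term T u p) \<le> exp ((\<bar>u\<bar> + 1)\<^sup>2 / T) * exp (- \<bar>real_of_int p\<bar>)" for p
  proof -
    define x where "x = \<bar>real_of_int p\<bar>"
    \<comment> \<open>Completing the square for the slope |u| + 1 instead of |u|: the surplus 1
      leaves the term -x that the comparison series consists of.\<close>
    have "0 \<le> (T * x / 2 - (\<bar>u\<bar> + 1))\<^sup>2" by simp
    hence "T * ((\<bar>u\<bar> + 1) * x - T * x\<^sup>2 / 4) \<le> (\<bar>u\<bar> + 1)\<^sup>2"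
      by (simp add: power2_eq_square algebra_simps)
    hence "(\<bar>u\<bar> + 1) * x - T * x\<^sup>2 / 4 \<le> (\<bar>u\<bar> + 1)\<^sup>2 / T"
      using assms by (simp add: field_simps)
    moreover have "of_int p * u \<le> \<bar>u\<bar> * x"
      unfolding x_def by (metis abs_ge_self abs_mult mult.commute)
    ultimately have "of_int p * u - T * x\<^sup>2 / 4 \<le> (\<bar>u\<bar> + 1)\<^sup>2 / T - x"
      by (simp add: algebra_simps)
    thus ?thesis unfolding gauss_term_def x_def by (simp flip: exp_add)
  qed
  have "(\<lambda>p. exp ((\<bar>u\<bar> + 1)\<^sup>2 / T) * exp (- \<bar>real_of_int p\<bar>)) summable_on UNIV"
    by (intro summable_on_cmult_right summable_on_exp_minus_abs_int)
  hence "gauss_term T u summable_on UNIV"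
    by (rule summable_on_comparison_test) (use bound in \<open>auto simp: gauss_term_def\<close>)
  thus ?thesis by (rule summable_on_subset) auto
qed

lemma half_term_eq_gauss_term: "half_term T w a = gauss_term (T / 2) (w / 2) (2 * a + 1)"
  unfolding half_term_def gauss_term_def
    by (rule arg_cong[of _ _ exp]) (simp add: power2_eq_square field_simps)

lemma half_term_summable: assumes "T > 0" shows "half_term T w summable_on A"
proof -
  have "gauss_term (T/2) (w/2) summable_on ((\<lambda>a. 2 * a + 1) ` A)"
    using assms by (intro gauss_term_summable) auto
  hence "(gauss_term (T/2) (w/2) \<circ> (\<lambda>a. 2 * a + 1)) summable_on A"
    by (subst (asm) summable_on_reindex) (auto simp: inj_on_def)
  thus ?thesis by (simp add: o_def half_term_eq_gauss_term[symmetric] cong: summable_on_cong)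
qed

lemma half_term_signed_summable:
  assumes "T > 0" shows "(\<lambda>a. (if even a then 1 else -1) * half_term T w a) summable_on A"
  using half_term_summable[OF assms, of w A]
  by (subst summable_on_iff_abs_summable_on_real)
     (auto simp: abs_mult half_term_pos less_imp_le elim!: summable_on_cong[THEN iffD1, rotated])

lemma infsum_pos:
  fixes f :: "'a \<Rightarrow> real"
  assumes "f summable_on A" "\<And>x. x \<in> A \<Longrightarrow> f x > 0" "a \<in> A"
  shows "infsum f A > 0"
proof -
  have "sum f {a} \<le> infsum f A"
    by (rule finite_sum_le_infsum) (use assms in \<open>auto intro: less_imp_le\<close>)
  with assms(2)[OF assms(3)] show ?thesis by simp
qed

lemma theta_pos:
  assumes "T > 0"
  shows "theta_even T u > 0" "theta_odd T u > 0" "theta_den T u > 0"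
  unfolding theta_even_def theta_odd_def theta_den_def
  by (rule infsum_pos[where a = 0] infsum_pos[where a = 1];
      use assms in \<open>simp add: gauss_term_summable half_term_summable gauss_term_pos half_term_pos\<close>)+

lemma half_term_mult: "half_term T (u + v) a * half_term T (u - v) b =
    gauss_term T u (a + b + 1) * gauss_term T v (a - b)"
  unfolding half_term_def gauss_term_def exp_add[symmetric] mult_exp_exp
  by (rule arg_cong[of _ _ exp]) (simp add: power2_eq_square field_simps)

lemma bij_betw_sum_diff:
  "bij_betw (\<lambda>(a,b). (a + b + 1, a - b :: int)) (UNIV :: (int \<times> int) set)
     ({p. odd p} \<times> {p. even p} \<union> {p. even p} \<times> {p. odd p})"
proof (rule bij_betw_byWitness[where f' = "\<lambda>(p,r). ((p + r - 1) div 2, (p - r - 1) div 2)"])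
  show "\<forall>a\<in>(UNIV :: (int \<times> int) set). (case case a of (a, b) \<Rightarrow> (a + b + 1, a - b) of
            (p, r) \<Rightarrow> ((p + r - 1) div 2, (p - r - 1) div 2)) = a"
    by auto
  show "\<forall>a'\<in>{p. odd p} \<times> {p. even p} \<union> {p. even p} \<times> {p. odd p}.
       (case case a' of (p, r) \<Rightarrow> ((p + r - 1) div 2, (p - r - 1) div 2) of
        (a, b) \<Rightarrow> (a + b + 1, a - b)) = (a' :: int \<times> int)"
    by (auto elim!: oddE evenE)
qed auto

text \<open>Both products are rearranged along \<open>p = a + b + 1\<close> and \<open>r = a - b\<close>, which have
  opposite parity.\<close>

lemma theta_mult:
  assumes "T > 0"
  shows theta_den_mult: "theta_den T (u + v) * theta_den T (u - v) =
           theta_odd T u * theta_even T v + theta_even T u * theta_odd T v" (is ?A)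
    and theta_num_mult: "theta_num T (u + v) * theta_num T (u - v) =
           theta_odd T u * theta_even T v - theta_even T u * theta_odd T v" (is ?B)
proof -
  let ?S = "{p::int. odd p} \<times> {p::int. even p}" and ?S' = "{p::int. even p} \<times> {p::int. odd p}"
  have s1: "((\<lambda>(p,r). gauss_term T u p * gauss_term T v r) has_sum (theta_odd T u *
      theta_even T v)) ?S"
    unfolding theta_odd_def theta_even_def by (intro has_sum_mult_Times gauss_term_summable assms)
  have s2: "((\<lambda>(p,r). gauss_term T u p * gauss_term T v r) has_sum (theta_even T u *
      theta_odd T v)) ?S'"
    unfolding theta_odd_def theta_even_def by (intro has_sum_mult_Times gauss_term_summable assms)
  \<comment> \<open>The sign (-1)^(a+b) depends only on the parity of p = a + b + 1, so \<sigma> = 1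
    gives the formula for \<open>theta_den\<close> and \<sigma> = -1 the one for
    \<open>theta_num\<close>.\<close>
  have s: "((\<lambda>(p,r). (if odd p then 1 else \<sigma>) * (gauss_term T u p * gauss_term T v r)) has_sum
      (theta_odd T u * theta_even T v + \<sigma> * (theta_even T u * theta_odd T v))) (?S \<union> ?S')" for \<sigma>
  proof (rule has_sum_Un_disjoint)
    show "((\<lambda>(p,r). (if odd p then 1 else \<sigma>) * (gauss_term T u p * gauss_term T v r)) has_sum
       (theta_odd T u * theta_even T v)) ?S"
      using s1 by (rule has_sum_cong[THEN iffD1, rotated]) auto
    show "((\<lambda>(p,r). (if odd p then 1 else \<sigma>) * (gauss_term T u p * gauss_term T v r)) has_sum
       \<sigma> * (theta_even T u * theta_odd T v)) ?S'"
      using has_sum_cmult_right[OF s2, of \<sigma>] by (rule has_sum_cong[THEN iffD1, rotated]) auto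
  qed auto
  have e: "(if odd (a + b + 1) then 1 else \<sigma>) * (gauss_term T u (a + b + 1) * gauss_term T v (a -
      b)) =
     (if even (a + b) then 1 else \<sigma>) * (half_term T (u + v) a * half_term T (u - v) b)" for a b \<sigma>
    by (simp add: half_term_mult)
  have s': "((\<lambda>(a,b). (if even (a + b) then 1 else \<sigma>) * (half_term T (u + v) a * half_term T (u -
      v) b)) has_sum
      (theta_odd T u * theta_even T v + \<sigma> * (theta_even T u * theta_odd T v))) UNIV" for \<sigma>
    using s[of \<sigma>] unfolding has_sum_reindex_bij_betw[OF bij_betw_sum_diff, symmetric]
    unfolding case_prod_unfold fst_conv snd_conv e .
  have A: "((\<lambda>(a,b). half_term T (u + v) a * half_term T (u - v) b) has_sum
      theta_den T (u + v) * theta_den T (u - v)) (UNIV \<times> UNIV)"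
    unfolding theta_den_def by (intro has_sum_mult_Times half_term_summable assms)
  show ?A using has_sum_unique[OF A[unfolded UNIV_Times_UNIV]] s'[of 1] by simp
  have B: "((\<lambda>(a,b). ((if even a then 1 else -1) * half_term T (u + v) a) *
      ((if even b then 1 else -1) * half_term T (u - v) b)) has_sum
      theta_num T (u + v) * theta_num T (u - v)) (UNIV \<times> UNIV)"
    unfolding theta_num_def by (intro has_sum_mult_Times half_term_signed_summable assms)
  have "(\<lambda>(a,b). ((if even a then 1 else -1) * half_term T (u + v) a) *
      ((if even b then 1 else -1) * half_term T (u - v) b)) =
    (\<lambda>(a,b). (if even (a + b) then 1 else -1) * (half_term T (u + v) a * half_term T (u - v) b))"
    by (auto simp: fun_eq_iff)
  thus ?B using has_sum_unique[OF B[unfolded UNIV_Times_UNIV]] s'[of "-1"] by simp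
qed

lemma gauss_term_convex: "convex_on UNIV (\<lambda>u. gauss_term T u p)"
proof (rule convex_onI)
  fix t x y :: real assume t: "0 < t" "t < 1"
  have "convex_on UNIV (exp :: real \<Rightarrow> real)" by (rule exp_convex)
  from convex_onD[OF this, of t "of_int p * x - T * (of_int p)\<^sup>2 / 4" "of_int p * y - T *
      (of_int p)\<^sup>2 / 4"] t
  have "exp ((1 - t) * (of_int p * x - T * (of_int p)\<^sup>2 / 4) + t * (of_int p * y - T *
      (of_int p)\<^sup>2 / 4)) \<le>
    (1 - t) * gauss_term T x p + t * gauss_term T y p" by (simp add: gauss_term_def)
  also have "(1 - t) * (of_int p * x - T * (of_int p)\<^sup>2 / 4) + t * (of_int p * y - T *
      (of_int p)\<^sup>2 / 4) =
     of_int p * ((1 - t) * x + t * y) - T * (of_int p)\<^sup>2 / 4"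
    by (simp add: field_simps)
  finally show "gauss_term T ((1 - t) *\<^sub>R x + t *\<^sub>R y) p \<le>
      (1 - t) * gauss_term T x p + t * gauss_term T y p"
    by (simp add: gauss_term_def)
qed auto

text \<open>A sum of exponentials is convex, and a finite convex function on the line is
  continuous.\<close>

lemma continuous_on_infsum_gauss_term:
  assumes "T > 0" shows "continuous_on UNIV (\<lambda>u. infsum (gauss_term T u) A)"
proof (rule convex_on_continuous)
  show "convex_on UNIV (\<lambda>u. infsum (gauss_term T u) A)"
  proof (rule convex_onI)
    fix t x y :: real assume t: "0 < t" "t < 1"
    have "infsum (gauss_term T ((1 - t) *\<^sub>R x + t *\<^sub>R y)) A \<le>
        infsum (\<lambda>p. (1 - t) * gauss_term T x p + t * gauss_term T y p) A"
      using t
        by (intro infsum_mono summable_on_add summable_on_cmult_right gauss_term_summable assms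
           convex_onD[OF gauss_term_convex]) auto
    also have "\<dots> = (1 - t) * infsum (gauss_term T x) A + t * infsum (gauss_term T y) A"
      by (subst infsum_add) (auto intro!: summable_on_cmult_right gauss_term_summable assms
          simp: infsum_cmult_right'  )
    finally show "infsum (gauss_term T ((1 - t) *\<^sub>R x + t *\<^sub>R y)) A \<le>
       (1 - t) * infsum (gauss_term T x) A + t * infsum (gauss_term T y) A" .
  qed auto
qed auto

section \<open>Values at 0 and quasi-periodicity\<close>

text \<open>Folding the odd indices about 0 gives 2 exp (-T/4) times the sum of exp (-T n (n + 1))
  over n >= 0. Termwise this is below the sum of exp (-T n^2), which is the nonnegative half of the
  even series. This estimate fixes the constant inside the first logarithm of the theorem.\<close>

lemma theta_odd_0_le:
  assumes "T > 0"
  shows "theta_odd T 0 \<le> 2 * exp (- T / 4) * theta_even T 0"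
proof -
  \<comment> \<open>Reflecting by n -> -1 - n suits both series: 2 (-1 - n) + 1 = -(2n + 1) makes
    the two halves of the odd series equal, and 2 (-1 - n) = -2 (n + 1) shifts the second half of
    the even series by one.\<close>
  have r: "infsum f UNIV = infsum (\<lambda>n. f (int n)) UNIV + infsum (\<lambda>n. f (- 1 - int n)) UNIV"
    if f: "f summable_on UNIV" for f :: "int \<Rightarrow> real"
  proof -
    have u: "UNIV = range int \<union> range (\<lambda>n. -1 - int n)"
    proof (intro Set.set_eqI iffI UNIV_I)
      fix x :: int
      show "x \<in> range int \<union> range (\<lambda>n. -1 - int n)"
      proof (cases "x \<ge> 0")
        case True
        hence "x = int (nat x)" by simp
        thus ?thesis by blast
      next
        case False
        hence "x = - 1 - int (nat (-1 - x))" by simp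
        thus ?thesis by blast
      qed
    qed
    have "infsum f UNIV = infsum f (range int) + infsum f (range (\<lambda>n. - 1 - int n))"
      by (subst u, rule infsum_Un_disjoint) (auto intro: summable_on_subset[OF f])
    thus ?thesis by (simp add: infsum_reindex inj_on_def o_def)
  qed
  define g where "g n = exp (- T * real n ^ 2)" for n
  define h where "h n = exp (- T / 4) * exp (- T * (real n * (real n + 1)))" for n
  have E1: "theta_even T 0 = infsum (\<lambda>n::int. gauss_term T 0 (2 * n)) UNIV"
    unfolding theta_even_def
    by (rule infsum_reindex_bij_witness[where i = "\<lambda>n. 2 * n" and j = "\<lambda>n. n div 2"]) auto
  have O1: "theta_odd T 0 = infsum (\<lambda>n::int. gauss_term T 0 (2 * n + 1)) UNIV"
    unfolding theta_odd_def
    by (rule infsum_reindex_bij_witness[where i = "\<lambda>n. 2 * n + 1" and j = "\<lambda>n. n div 2"]) auto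
  have sE: "(\<lambda>n::int. gauss_term T 0 (2 * n)) summable_on UNIV"
    using summable_on_reindex[of "\<lambda>n. 2 * n" UNIV "gauss_term T 0"] gauss_term_summable[OF assms, of
        0 "range (\<lambda>n. 2 * n)"]
    by (simp add: inj_on_def o_def)
  have sO: "(\<lambda>n::int. gauss_term T 0 (2 * n + 1)) summable_on UNIV"
    using summable_on_reindex[of "\<lambda>n. 2 * n + 1" UNIV "gauss_term T 0"] gauss_term_summable[OF
        assms, of 0 "range (\<lambda>n. 2 * n + 1)"]
    by (simp add: inj_on_def o_def)
  have sg: "g summable_on UNIV"
  proof -
    have "(\<lambda>n::int. gauss_term T 0 (2 * n)) summable_on range int"
      using sE by (rule summable_on_subset) auto
    hence "(\<lambda>n. gauss_term T 0 (2 * int n)) summable_on UNIV"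
      by (subst (asm) summable_on_reindex) (auto simp: o_def)
    thus ?thesis
      by (simp add: g_def gauss_term_def power2_eq_square algebra_simps cong: summable_on_cong)
  qed
  have sh: "h summable_on UNIV"
  proof -
    have "(\<lambda>n::int. gauss_term T 0 (2 * n + 1)) summable_on range int"
      using sO by (rule summable_on_subset) auto
    hence "(\<lambda>n. gauss_term T 0 (2 * int n + 1)) summable_on UNIV"
      by (subst (asm) summable_on_reindex) (auto simp: o_def)
    moreover have "gauss_term T 0 (2 * int n + 1) = h n" for n
      unfolding h_def gauss_term_def mult_exp_exp
        by (rule arg_cong[of _ _ exp]) (simp add: power2_eq_square field_simps)
    ultimately show ?thesis by simp
  qed
  have "gauss_term T 0 (2 * (- 1 - int n) + 1) = h n" "gauss_term T 0 (2 * int n + 1) = h n" for n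
    unfolding h_def gauss_term_def mult_exp_exp
      by (rule arg_cong[of _ _ exp], simp add: power2_eq_square field_simps)+
  hence O2: "theta_odd T 0 = 2 * infsum h UNIV"
    unfolding O1 r[OF sO] by simp
  have "gauss_term T 0 (2 * (- 1 - int n)) = g (Suc n)" "gauss_term T 0 (2 * int n) = g n" for n
    unfolding g_def gauss_term_def
      by (rule arg_cong[of _ _ exp], simp add: power2_eq_square field_simps)+
  hence E2: "theta_even T 0 = infsum g UNIV + infsum (\<lambda>n. g (Suc n)) UNIV"
    unfolding E1 r[OF sE] by simp
  have sg': "(\<lambda>n. g (Suc n)) summable_on UNIV"
    using summable_on_reindex[of Suc UNIV g] summable_on_subset[OF sg, of "range Suc"]
      by (simp add: o_def)
  have "infsum h UNIV \<le> infsum (\<lambda>n. exp (- T / 4) * g n) UNIV"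
  proof (rule infsum_mono[OF sh])
    show "(\<lambda>n. exp (- T / 4) * g n) summable_on UNIV" by (intro summable_on_cmult_right sg)
    show "h n \<le> exp (- T / 4) * g n" for n
      using assms by (simp add: h_def g_def power2_eq_square mult_left_mono)
  qed
  also have "\<dots> = exp (- T / 4) * infsum g UNIV" by (simp add: infsum_cmult_right')
  finally have "theta_odd T 0 \<le> 2 * (exp (- T / 4) * infsum g UNIV)" unfolding O2 by simp
  also have "\<dots> \<le> 2 * exp (- T / 4) * theta_even T 0"
    unfolding E2 using infsum_nonneg[of UNIV "\<lambda>n. g (Suc n)"] by (simp add: g_def)
  finally show ?thesis .
qed

text \<open>Completing the square moves the index by one, which exchanges the two parity classes.
  The common factor cancels in the quotient, so half a period inverts
  \<open>theta_ratio\<close>.\<close>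

lemma theta_half_shift:
  assumes "T > 0"
  shows "theta_even T (u + T / 2) = exp (u + T / 4) * theta_odd T u"
    and "theta_odd T (u + T / 2) = exp (u + T / 4) * theta_even T u"
proof -
  have e: "gauss_term T (u + T / 2) p = exp (u + T / 4) * gauss_term T u (p - 1)" for p
    unfolding gauss_term_def mult_exp_exp
      by (rule arg_cong[of _ _ exp]) (simp add: power2_eq_square field_simps)
  show "theta_even T (u + T / 2) = exp (u + T / 4) * theta_odd T u"
    unfolding theta_even_def theta_odd_def infsum_cmult_right'[symmetric]
    by (rule infsum_reindex_bij_witness[where j = "\<lambda>p. p - 1" and i = "\<lambda>p. p + 1"]) (auto simp: e)
  show "theta_odd T (u + T / 2) = exp (u + T / 4) * theta_even T u"
    unfolding theta_even_def theta_odd_def infsum_cmult_right'[symmetric]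
    by (rule infsum_reindex_bij_witness[where j = "\<lambda>p. p - 1" and i = "\<lambda>p. p + 1"]) (auto simp: e)
qed

lemma theta_den_shift: "theta_den T (w + T) = exp (w + T / 2) * theta_den T w"
proof -
  have e: "half_term T (w + T) a = exp (w + T / 2) * half_term T w (a - 1)" for a
    unfolding half_term_def mult_exp_exp
      by (rule arg_cong[of _ _ exp]) (simp add: power2_eq_square field_simps)
  show ?thesis
    unfolding theta_den_def infsum_cmult_right'[symmetric]
    by (rule infsum_reindex_bij_witness[where j = "\<lambda>p. p - 1" and i = "\<lambda>p. p + 1"]) (auto simp: e)
qed

lemma theta_num_shift: "theta_num T (w + T) = - exp (w + T / 2) * theta_num T w"
proof -
  have e: "half_term T (w + T) a = exp (w + T / 2) * half_term T w (a - 1)" for a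
    unfolding half_term_def mult_exp_exp
      by (rule arg_cong[of _ _ exp]) (simp add: power2_eq_square field_simps)
  show ?thesis
    unfolding theta_num_def infsum_cmult_right'[symmetric]
    by (rule infsum_reindex_bij_witness[where j = "\<lambda>p. p - 1" and i = "\<lambda>p. p + 1"]) (auto simp: e)
qed

section \<open>Product formula for the theta quotient\<close>

definition q_factorial :: "real \<Rightarrow> nat \<Rightarrow> real" where
  "q_factorial q n = (\<Prod>i<n. 1 - q ^ Suc i)"

text \<open>The value 0 beyond N makes the Pascal rule hold at the edge k = N and lets a sum over k
  <= N run one index further.\<close>

definition q_binomial :: "real \<Rightarrow> nat \<Rightarrow> nat \<Rightarrow> real" where
  "q_binomial q N k = (if k \<le> N then q_factorial q N / (q_factorial q k * q_factorial q (N -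
      k)) else 0)"

lemma q_factorial_0 [simp]: "q_factorial q 0 = 1" by (simp add: q_factorial_def)

lemma q_factorial_Suc: "q_factorial q (Suc n) = q_factorial q n * (1 - q ^ Suc n)"
  by (simp add: q_factorial_def)

lemma q_factorial_pos: assumes "0 < q" "q < 1" shows "q_factorial q n > 0"
  unfolding q_factorial_def
proof (rule prod_pos)
  fix i
  have "q ^ Suc i < 1" using assms by (intro power_Suc_less_one) auto
  thus "0 < 1 - q ^ Suc i" by (simp only: diff_gt_0_iff_gt)
qed

text \<open>Of the two q-Pascal rules, this is the one that fits splitting off the last factor
  \<open>1 + q ^ N * x\<close>: the weight q^(N-k) combines with the q^k by which the Gaussian
  weights of k + 1 and k differ.\<close>

lemma q_binomial_pascal:
  assumes q: "0 < q" "q < 1" and k: "k \<le> N"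
  shows "q_binomial q (Suc N) (Suc k) = q_binomial q N (Suc k) + q ^ (N - k) * q_binomial q N k"
proof (cases "k = N")
  case True
  thus ?thesis
    using q_factorial_pos[OF q, of N] q_factorial_pos[OF q, of "Suc N"]
    by (simp add: q_binomial_def)
next
  case False
  then obtain d where d: "N = k + Suc d"
    using k by (metis add_Suc_right le_neq_implies_less less_imp_Suc_add)
  have nz: "q_factorial q k \<noteq> 0" "q_factorial q d \<noteq> 0" "1 - q ^ Suc k \<noteq> 0" "1 - q ^ Suc d \<noteq> 0"
    using q_factorial_pos[OF q] q_factorial_pos[OF q, of "Suc k"] q_factorial_pos[OF q, of "Suc d"]
    by (auto simp: q_factorial_Suc less_le)
  have e: "q ^ Suc N = q ^ Suc d * q ^ Suc k" unfolding d by (simp add: power_add)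
  have l: "q_binomial q (Suc N) (Suc k) =
      q_factorial q N * (1 - q ^ Suc N) / (q_factorial q k * (1 - q ^ Suc k) * (q_factorial q d * (1
      - q ^ Suc d)))"
    unfolding q_binomial_def
      by (simp add: d q_factorial_Suc[of q k] q_factorial_Suc[of q d] q_factorial_Suc[of q "Suc (k +
        d)"] del: power_Suc)
  have r: "q_binomial q N (Suc k) = q_factorial q N / (q_factorial q k * (1 - q ^ Suc k) *
      q_factorial q d)"
     "q_binomial q N k = q_factorial q N / (q_factorial q k * (q_factorial q d * (1 -
         q ^ Suc d)))" "N - k = Suc d"
    unfolding q_binomial_def
      by (auto simp: d q_factorial_Suc[of q k] q_factorial_Suc[of q d] simp del: power_Suc)
  show ?thesis
    unfolding l r e using nz by (simp add: divide_simps del: power_Suc) (simp add: algebra_simps)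
qed

lemma q_binomial_theorem:
  assumes q: "0 < q" "q < 1"
  shows "(\<Prod>j<N. 1 + q ^ j * x) = (\<Sum>k\<le>N. q ^ (k choose 2) * q_binomial q N k * x ^ k)"
proof (induction N)
  case 0
  thus ?case by (simp add: q_binomial_def binomial_eq_0)
next
  case (Suc N)
  let ?t = "\<lambda>N k. q ^ (k choose 2) * q_binomial q N k * x ^ k"
  have c: "(Suc k choose 2) = k + (k choose 2)" for k
    by (simp add: numeral_2_eq_2)
  have c0: "(0 choose 2) = (0 :: nat)" by (simp add: numeral_2_eq_2)
  have 0: "?t M 0 = 1" for M using q_factorial_pos[OF q, of M] by (simp add: q_binomial_def c0)
  have step: "?t (Suc N) (Suc k) = ?t N (Suc k) + q ^ N * x * ?t N k" if "k \<le> N" for k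
  proof -
    have "q ^ N = q ^ (N - k) * q ^ k" using that by (simp flip: power_add)
    thus ?thesis unfolding q_binomial_pascal[OF q that] c by (simp add: algebra_simps power_add)
  qed
  have "(\<Prod>j<Suc N. 1 + q ^ j * x) = (\<Sum>k\<le>N. ?t N k) + q ^ N * x * (\<Sum>k\<le>N. ?t N k)"
    unfolding Suc.IH[symmetric] by (simp add: algebra_simps)
  also have "q ^ N * x * (\<Sum>k\<le>N. ?t N k) = (\<Sum>k\<le>N. q ^ N * x * ?t N k)" by (rule sum_distrib_left)
  also have "(\<Sum>k\<le>N. ?t N k) = (\<Sum>k\<le>Suc N. ?t N k)" by (simp add: q_binomial_def)
  also have "\<dots> = 1 + (\<Sum>k\<le>N. ?t N (Suc k))"
    by (subst sum.atMost_Suc_shift) (simp add: 0[simplified])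
  also have "1 + (\<Sum>k\<le>N. ?t N (Suc k)) + (\<Sum>k\<le>N. q ^ N * x * ?t N k) = 1 + (\<Sum>k\<le>N. ?t (Suc N) (Suc k))"
    unfolding add.assoc sum.distrib[symmetric]
      by (intro arg_cong2[where f = "(+)"] refl sum.cong step[symmetric]) auto
  also have "\<dots> = (\<Sum>k\<le>Suc N. ?t (Suc N) k)"
    by (subst sum.atMost_Suc_shift) (simp add: 0[simplified])
  finally show ?case .
qed

text \<open>The coefficients of the finite triple product, divided by the middle one. The common factor
  cancels in the quotient of two theta functions, so the infinite product is never needed.\<close>

definition q_coeff :: "real \<Rightarrow> nat \<Rightarrow> int \<Rightarrow> real" where
  "q_coeff q n a = (if \<bar>a\<bar> \<le> int n then (q_factorial q n)\<^sup>2 / (q_factorial q (nat (int n + a)) *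
      q_factorial q (nat (int n - a))) else 0)"

section \<open>From finite products to theta quotients\<close>

text \<open>The limit is Euler's infinite product. Its positivity bounds \<open>q_coeff\<close>
  uniformly in both indices, and it cancels in the limit of each coefficient.\<close>

lemma q_factorial_limit:
  assumes q: "0 < q" "q < 1"
  obtains L where "L > 0" "q_factorial q \<longlonglongrightarrow> L" "\<And>n. L \<le> q_factorial q n" "\<And>n. q_factorial q n \<le> 1"
proof -
  have "summable (\<lambda>i. norm (- (q ^ Suc i)))"
    using q by (simp add: summable_mult summable_geometric)
  hence "abs_convergent_prod (\<lambda>i. 1 + - (q ^ Suc i))"
    unfolding abs_convergent_prod_conv_summable by simp
  hence c: "convergent_prod (\<lambda>i. 1 - q ^ Suc i)"
    by (simp add: abs_convergent_prod_imp_convergent_prod)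
  have lt: "q ^ Suc i < 1" for i using q by (intro power_Suc_less_one) auto
  define L where "L = prodinf (\<lambda>i. 1 - q ^ Suc i)"
  have "(\<lambda>n. \<Prod>i\<le>n. 1 - q ^ Suc i) \<longlonglongrightarrow> L" unfolding L_def by (rule convergent_prod_LIMSEQ[OF c])
  hence lim: "q_factorial q \<longlonglongrightarrow> L" unfolding q_factorial_def
    by (subst filterlim_sequentially_Suc[symmetric]) (simp add: lessThan_Suc_atMost)
  have dec: "decseq (q_factorial q)"
    unfolding decseq_Suc_iff q_factorial_Suc using q_factorial_pos[OF q] q
    by (auto intro!: mult_left_le less_imp_le simp del: power_Suc)
  have le: "L \<le> q_factorial q n" for n using decseq_ge[OF dec lim] by simp
  have "L \<noteq> 0" unfolding L_def by (rule prodinf_nonzero[OF c]) (use lt in \<open>auto simp: less_le\<close>)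
  moreover have "L \<ge> 0"
    by (rule LIMSEQ_le_const[OF lim]) (use q_factorial_pos[OF q] in \<open>auto intro: less_imp_le\<close>)
  moreover have "q_factorial q n \<le> 1" for n using decseqD[OF dec, of 0 n] by simp
  ultimately show ?thesis using that[of L] lim le by simp
qed

lemma q_coeff_nonneg: assumes q: "0 < q" "q < 1" shows "0 \<le> q_coeff q n a"
  unfolding q_coeff_def using q_factorial_pos[OF q] by (auto intro!: divide_nonneg_pos mult_pos_pos)

lemma q_coeff_tendsto: assumes q: "0 < q" "q < 1" shows "(\<lambda>n. q_coeff q n a) \<longlonglongrightarrow> 1"
proof -
  obtain L where L: "L > 0" "q_factorial q \<longlonglongrightarrow> L" using q_factorial_limit[OF q] by metis
  have f: "filterlim (\<lambda>n. nat (int n + b)) at_top at_top" for b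
    unfolding filterlim_at_top eventually_at_top_linorder
  proof
    fix Z show "\<exists>N. \<forall>n\<ge>N. Z \<le> nat (int n + b)" by (rule exI[of _ "Z + nat \<bar>b\<bar>"]) auto
  qed
  have "(\<lambda>n. (q_factorial q n)\<^sup>2 / (q_factorial q (nat (int n + a)) * q_factorial q (nat (int n +
      (- a))))) \<longlonglongrightarrow> L\<^sup>2 / (L * L)"
    using L by (intro tendsto_intros filterlim_compose[OF L(2) f]) auto
  moreover have "\<forall>\<^sub>F n in sequentially. (q_factorial q n)\<^sup>2 / (q_factorial q (nat (int n + a)) *
      q_factorial q (nat (int n + (- a)))) = q_coeff q n a"
    using eventually_ge_at_top[of "nat \<bar>a\<bar>"] by eventually_elim (auto simp: q_coeff_def)
  ultimately show ?thesis using L by (subst (asm) tendsto_cong) (auto simp: power2_eq_square)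
qed

text \<open>Outside a large finite set the factor \<open>e n a - 1\<close> costs at most B + 1 times
  a small tail of the absolutely convergent series; inside it only finitely many limits have to be
  taken.\<close>

lemma tannery_infsum:
  fixes t :: "'a \<Rightarrow> real" and e :: "nat \<Rightarrow> 'a \<Rightarrow> real"
  assumes t: "t summable_on UNIV" and e: "\<And>n a. \<bar>e n a\<bar> \<le> B" and lim: "\<And>a. (\<lambda>n. e n a) \<longlonglongrightarrow> 1"
  shows "(\<lambda>n. infsum (\<lambda>a. e n a * t a) UNIV) \<longlonglongrightarrow> infsum t UNIV"
proof (rule LIMSEQ_I)
  fix r :: real assume r: "r > 0"
  have B: "B \<ge> 0" using e[of 0 undefined] by linarith
  have ta: "(\<lambda>a. \<bar>t a\<bar>) summable_on A" for A
    using t summable_on_iff_abs_summable_on_real[of t UNIV] summable_on_subset[of _ UNIV A] by auto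
  define s where "s = r / (2 * (B + 1))"
  have s: "s > 0" "(B + 1) * s = r / 2" using r B by (auto simp: s_def divide_simps)
  obtain F where F: "finite F" "dist (sum (\<lambda>a. \<bar>t a\<bar>) F) (infsum (\<lambda>a. \<bar>t a\<bar>) UNIV) \<le> s"
    using infsum_finite_approximation[OF ta[of UNIV] s(1)] by auto
  have "infsum (\<lambda>a. \<bar>t a\<bar>) UNIV = infsum (\<lambda>a. \<bar>t a\<bar>) (F \<union> - F)" by simp
  also have "\<dots> = sum (\<lambda>a. \<bar>t a\<bar>) F + infsum (\<lambda>a. \<bar>t a\<bar>) (- F)"
    by (subst infsum_Un_disjoint) (use F ta in auto)
  finally have tail: "infsum (\<lambda>a. \<bar>t a\<bar>) (- F) \<le> s" using F(2) by (simp add: dist_real_def)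
  have et: "(\<lambda>a. e n a * t a) summable_on UNIV" for n
  proof -
    have "(\<lambda>a. \<bar>e n a * t a\<bar>) summable_on UNIV"
    proof (rule summable_on_comparison_test)
      show "(\<lambda>a. B * \<bar>t a\<bar>) summable_on UNIV" by (rule summable_on_cmult_right[OF ta])
      show "\<bar>e n a * t a\<bar> \<le> B * \<bar>t a\<bar>" for a
        using e[of n a] by (auto simp: abs_mult intro!: mult_right_mono)
    qed auto
    thus ?thesis using summable_on_iff_abs_summable_on_real by force
  qed
  have dt: "(\<lambda>a. \<bar>(e n a - 1) * t a\<bar>) summable_on A" for n A
  proof -
    have "(\<lambda>a. e n a * t a + - t a) summable_on UNIV"
      using et t by (intro summable_on_add) (auto simp: summable_on_uminus)
    hence "(\<lambda>a. (e n a - 1) * t a) summable_on UNIV" by (simp add: algebra_simps)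
    hence "(\<lambda>a. \<bar>(e n a - 1) * t a\<bar>) summable_on UNIV"
      using summable_on_iff_abs_summable_on_real by force
    thus ?thesis by (rule summable_on_subset) auto
  qed
  have bound: "\<bar>infsum (\<lambda>a. e n a * t a) UNIV - infsum t UNIV\<bar> \<le>
      (\<Sum>a\<in>F. \<bar>(e n a - 1) * t a\<bar>) + r / 2" for n
  proof -
    have "infsum (\<lambda>a. e n a * t a) UNIV - infsum t UNIV = infsum (\<lambda>a. (e n a - 1) * t a) UNIV"
      using infsum_add[OF et summable_on_uminus[THEN iffD2, OF t]]
        by (simp add: algebra_simps infsum_uminus)
    also have "\<bar>\<dots>\<bar> \<le> infsum (\<lambda>a. \<bar>(e n a - 1) * t a\<bar>) UNIV"
      using norm_infsum_bound[of "\<lambda>a. (e n a - 1) * t a" UNIV] dt by auto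
    also have "\<dots> = infsum (\<lambda>a. \<bar>(e n a - 1) * t a\<bar>) (F \<union> - F)" by simp
    also have "\<dots> = (\<Sum>a\<in>F. \<bar>(e n a - 1) * t a\<bar>) + infsum (\<lambda>a. \<bar>(e n a - 1) * t a\<bar>) (- F)"
      by (subst infsum_Un_disjoint) (use F dt in auto)
    also have "infsum (\<lambda>a. \<bar>(e n a - 1) * t a\<bar>) (- F) \<le> infsum (\<lambda>a. (B + 1) * \<bar>t a\<bar>) (- F)"
    proof (rule infsum_mono[OF dt summable_on_cmult_right[OF ta]])
      fix a show "\<bar>(e n a - 1) * t a\<bar> \<le> (B + 1) * \<bar>t a\<bar>"
        unfolding abs_mult by (rule mult_right_mono) (use e[of n a] in auto)
    qed
    also have "\<dots> = (B + 1) * infsum (\<lambda>a. \<bar>t a\<bar>) (- F)" by (rule infsum_cmult_right')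
    also have "\<dots> \<le> (B + 1) * s" using tail B by (intro mult_left_mono) auto
    finally show ?thesis using s by simp
  qed
  have "(\<lambda>n. \<Sum>a\<in>F. \<bar>(e n a - 1) * t a\<bar>) \<longlonglongrightarrow> (\<Sum>a\<in>F. \<bar>(1 - 1) * t a\<bar>)"
    by (intro tendsto_intros lim)
  hence "\<forall>\<^sub>F n in sequentially. (\<Sum>a\<in>F. \<bar>(e n a - 1) * t a\<bar>) < r / 2"
    using r by (intro order_tendstoD(2)) auto
  then obtain N where "\<And>n. n \<ge> N \<Longrightarrow> (\<Sum>a\<in>F. \<bar>(e n a - 1) * t a\<bar>) < r / 2"
    unfolding eventually_at_top_linorder by blast
  thus "\<exists>N. \<forall>n\<ge>N. norm (infsum (\<lambda>a. e n a * t a) UNIV - infsum t UNIV) < r"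
    using bound by (intro exI[of _ N]) (smt (verit, best) field_sum_of_halves real_norm_def)
qed

lemma q_coeff_bounded:
  assumes q: "0 < q" "q < 1" obtains B where "\<And>n a. \<bar>q_coeff q n a\<bar> \<le> B"
proof -
  obtain L where L: "L > 0" "\<And>n. L \<le> q_factorial q n" "\<And>n. q_factorial q n \<le> 1"
    using q_factorial_limit[OF q] by metis
  have "\<bar>q_coeff q n a\<bar> \<le> 1 / (L * L)" for n a
  proof -
    have "(q_factorial q n)\<^sup>2 / (q_factorial q (nat (int n + a)) * q_factorial q (nat (int n -
        a))) \<le> 1 / (L * L)"
      using L
        by (intro frac_le mult_mono)
          (auto simp: power2_eq_square intro!: mult_le_one less_imp_le[OF q_factorial_pos[OF q]])
    thus ?thesis using q_coeff_nonneg[OF q, of n a] L unfolding q_coeff_def by auto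
  qed
  thus ?thesis using that by blast
qed

text \<open>In this exponential form the numerators and the denominators of a product of such
  factors are separately finite theta products.\<close>

definition abs_tanh_half :: "real \<Rightarrow> real" where "abs_tanh_half y = \<bar>1 - exp y\<bar> / (1 + exp y)"

text \<open>A finite Jacobi triple product. The shifts j + 1 - n run through the integers from 1 - n
  to n. In the q-binomial expansion the index is centred by k = n + a, and the power of q together
  with x^k then becomes a Gaussian in a + 1/2. The parameter \<sigma> treats both theta series at
  once.\<close>

lemma finite_theta_product:
  assumes T: "T > 0" and \<sigma>: "\<sigma> = 1 \<or> \<sigma> = (-1 :: real)"
  shows "(\<Prod>j<2*n. 1 + \<sigma> * exp (w - (real j + 1 - real n) * T)) =
    q_binomial (exp (-T)) (2*n) n * \<sigma> ^ n * exp (w * real n - w / 2 + T * (real n * (real n - 1) / 2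
        + 1 / 8)) *
    infsum (\<lambda>a. q_coeff (exp (-T)) n a * ((if even a then 1 else \<sigma>) * half_term T w a)) UNIV"
proof -
  define q where "q = exp (-T)"
  have q: "0 < q" "q < 1" using T by (auto simp: q_def)
  define x where "x = \<sigma> * exp (w - (1 - real n) * T)"
  define K where "K = exp (w * real n - w / 2 + T * (real n * (real n - 1) / 2 + 1 / 8))"
  have qp: "q ^ k = exp (- T * real k)" for k
    unfolding q_def by (simp flip: exp_of_nat_mult add: mult_ac)
  have ch: "real (k choose 2) = real k * (real k - 1) / 2" for k
    by (induction k) (auto simp: numeral_2_eq_2 field_simps)
  have "(\<Prod>j<2*n. 1 + \<sigma> * exp (w - (real j + 1 - real n) * T)) = (\<Prod>j<2*n. 1 + q ^ j * x)"
    unfolding x_def qp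
      by (intro prod.cong refl) (simp add: mult.left_commute mult_exp_exp algebra_simps)
  also have "\<dots> = (\<Sum>k\<le>2*n. q ^ (k choose 2) * q_binomial q (2*n) k * x ^ k)"
    by (rule q_binomial_theorem[OF q])
  also have "\<dots> = (\<Sum>a\<in>{- int n..int n}. q_binomial q (2*n) n * \<sigma> ^ n * K * (q_coeff q n a *
      ((if even a then 1 else \<sigma>) * half_term T w a)))"
  proof (rule sum.reindex_bij_witness[where i = "\<lambda>a. nat (a + int n)" and j = "\<lambda>k. int k - int n"])
    fix k assume k: "k \<in> {..2*n}"
    define a where "a = int k - int n"
    have ra: "real_of_int a = real k - real n" by (simp add: a_def)
    have na: "nat (int n + a) = k" "nat (int n - a) = 2*n - k" "\<bar>a\<bar> \<le> int n"
      using k by (auto simp: a_def)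
    have qb: "q_binomial q (2*n) k = q_binomial q (2*n) n * q_coeff q n a"
      unfolding q_coeff_def q_binomial_def
        using k na q_factorial_pos[OF q, of n] by (simp add: power2_eq_square)
    have sg: "\<sigma> ^ k = \<sigma> ^ n * (if even a then 1 else \<sigma>)"
      using \<sigma> by (auto simp: a_def minus_one_power_iff)
    have ex: "exp (- T * real (k choose 2)) * exp (real k * (w - (1 - real n) * T)) =
        K * half_term T w a"
      unfolding K_def half_term_def mult_exp_exp ra ch
      by (rule arg_cong[of _ _ exp]) (simp add: power2_eq_square field_simps)
    have "q ^ (k choose 2) * q_binomial q (2*n) k * x ^ k =
        q_binomial q (2*n) k * \<sigma> ^ k * (exp (- T * real (k choose 2)) * exp (real k * (w - (1 - real
        n) * T)))"
      unfolding x_def power_mult_distrib qp exp_of_nat_mult by simp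
    also have "\<dots> = q_binomial q (2*n) n * \<sigma> ^ n * K * (q_coeff q n a * ((if even a then 1 else \<sigma>) *
        half_term T w a))"
      unfolding ex sg qb by simp
    finally show "q_binomial q (2*n) n * \<sigma> ^ n * K * (q_coeff q n (int k - int n) *
        ((if even (int k - int n) then 1 else \<sigma>) * half_term T w (int k - int n))) = q ^ (k choose
        2) * q_binomial q (2*n) k * x ^ k"
      unfolding a_def by simp
  qed auto
  also have "\<dots> = q_binomial q (2*n) n * \<sigma> ^ n * K * (\<Sum>a\<in>{- int n..int n}. q_coeff q n a *
      ((if even a then 1 else \<sigma>) * half_term T w a))"
    by (simp only: sum_distrib_left)
  also have "(\<Sum>a\<in>{- int n..int n}. q_coeff q n a * ((if even a then 1 else \<sigma>) * half_term T w a)) =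
      infsum (\<lambda>a. q_coeff q n a * ((if even a then 1 else \<sigma>) * half_term T w a)) {- int n..int n}"
    by simp
  also have "\<dots> = infsum (\<lambda>a. q_coeff q n a * ((if even a then 1 else \<sigma>) * half_term T w a)) UNIV"
    by (rule infsum_cong_neutral) (auto simp: q_coeff_def)
  finally show ?thesis unfolding q_def K_def .
qed

text \<open>The factors in front of the two finite expansions agree up to sign, so they cancel in
  absolute value, and only two sums with coefficients tending to 1 have to be passed to the
  limit.\<close>

lemma theta_product_limit:
  assumes T: "T > 0"
  shows "(\<lambda>n. \<Prod>j<2*n. abs_tanh_half (w - (real j + 1 - real n) * T)) \<longlonglongrightarrow>
      \<bar>theta_num T w\<bar> / theta_den T w"
proof -
  define q where "q = exp (-T)"
  have q: "0 < q" "q < 1" using T by (auto simp: q_def)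
  obtain B where B: "\<And>n a. \<bar>q_coeff q n a\<bar> \<le> B" using q_coeff_bounded[OF q] by metis
  let ?f = "\<lambda>\<sigma> n. infsum (\<lambda>a. q_coeff q n a * ((if even a then 1 else \<sigma>) * half_term T w a)) UNIV"
  have 1: "?f 1 \<longlonglongrightarrow> theta_den T w"
    using tannery_infsum[OF half_term_summable[OF T, where w = w
        and A = UNIV] B q_coeff_tendsto[OF q]] by (simp add: theta_den_def)
  have 2: "?f (-1) \<longlonglongrightarrow> theta_num T w"
    unfolding theta_num_def
      by (rule tannery_infsum[OF half_term_signed_summable[OF T] B q_coeff_tendsto[OF q]])
  have "(\<Prod>j<2*n. abs_tanh_half (w - (real j + 1 - real n) * T)) = \<bar>?f (-1) n\<bar> / ?f 1 n" for n
  proof -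
    define K where "K = q_binomial q (2*n) n * exp (w * real n - w / 2 + T * (real n * (real n -
        1) / 2 + 1 / 8))"
    have K: "K > 0" unfolding K_def using q_factorial_pos[OF q] by (simp add: q_binomial_def)
    have a: "(\<Prod>j<2*n. 1 + exp (w - (real j + 1 - real n) * T)) = K * ?f 1 n"
      using finite_theta_product[OF T, of 1 w n] unfolding q_def K_def by simp
    have "(\<Prod>j<2*n. 1 - exp (w - (real j + 1 - real n) * T)) = (-1) ^ n * K * ?f (-1) n"
      using finite_theta_product[OF T, of "-1" w n] unfolding q_def K_def by simp
    hence "\<bar>\<Prod>j<2*n. 1 - exp (w - (real j + 1 - real n) * T)\<bar> = K * \<bar>?f (-1) n\<bar>"
      using K by (simp add: abs_mult power_abs)
    thus ?thesis unfolding abs_tanh_half_def prod_dividef abs_prod[symmetric] a using K by simp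
  qed
  moreover have "(\<lambda>n. \<bar>?f (-1) n\<bar> / ?f 1 n) \<longlonglongrightarrow> \<bar>theta_num T w\<bar> / theta_den T w"
    using 1 2 theta_pos(3)[OF T, of w] by (intro tendsto_intros) auto
  ultimately show ?thesis by simp
qed

section \<open>Zolotarev's problem\<close>

text \<open>Up to scaling of the argument, \<open>scaled_sn\<close> is \<open>\<bar>\<surd>k sn\<bar>\<close>, and
  \<open>theta_ratio\<close> runs through \<open>[1/b, b]\<close> as \<open>u\<close> runs through half a period.\<close>

definition scaled_sn :: "real \<Rightarrow> real \<Rightarrow> real" where "scaled_sn T w = \<bar>theta_num T w\<bar> / theta_den T w"
definition theta_ratio :: "real \<Rightarrow> real \<Rightarrow> real" where "theta_ratio T u =
    theta_odd T u / theta_even T u"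

context
  fixes T :: real
  assumes T: "T > 0"
begin

unbundle no vec_syntax

section \<open>Theta series\<close>

lemma theta_ratio_pos: "theta_ratio T u > 0" using theta_pos[OF T] by (simp add: theta_ratio_def)

lemma scaled_sn_nonneg: "scaled_sn T w \<ge> 0"
  using theta_pos(3)[OF T, of w] by (simp add: scaled_sn_def)

lemma scaled_sn_mult: "scaled_sn T (u + v) * scaled_sn T (u - v) =
    \<bar>theta_ratio T u - theta_ratio T v\<bar> / (theta_ratio T u + theta_ratio T v)"
proof -
  note p = theta_pos[OF T, of u] theta_pos[OF T, of v]
  define e where "e = theta_even T u * theta_even T v"
  have e: "e > 0" using p by (simp add: e_def)
  have 1: "theta_odd T u * theta_even T v - theta_even T u * theta_odd T v =
      e * (theta_ratio T u - theta_ratio T v)"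
    "theta_odd T u * theta_even T v + theta_even T u * theta_odd T v =
        e * (theta_ratio T u + theta_ratio T v)"
    using p by (simp_all add: theta_ratio_def e_def field_simps)
  have "scaled_sn T (u + v) * scaled_sn T (u - v) =
      \<bar>theta_num T (u + v) * theta_num T (u - v)\<bar> / (theta_den T (u + v) * theta_den T (u - v))"
    by (simp add: scaled_sn_def abs_mult)
  also have "\<dots> = \<bar>theta_ratio T u - theta_ratio T v\<bar> / (theta_ratio T u + theta_ratio T v)"
    unfolding theta_den_mult[OF T] theta_num_mult[OF T] 1 abs_mult using e by simp
  finally show ?thesis .
qed

lemma scaled_sn_shift: "scaled_sn T (w + T) = scaled_sn T w"
  by (simp add: scaled_sn_def theta_den_shift theta_num_shift abs_mult)

lemma theta_ratio_shift: "theta_ratio T (u + T / 2) = 1 / theta_ratio T u"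
  by (simp add: theta_ratio_def theta_half_shift[OF T])

lemma theta_ratio_minus: "theta_ratio T (- u) = theta_ratio T u"
proof -
  have "infsum (gauss_term T (-u)) A = infsum (gauss_term T u) A" if "\<And>p. p \<in> A \<Longrightarrow> - p \<in> A" for A
    by (rule infsum_reindex_bij_witness[where i = uminus and j = uminus])
        (auto simp: gauss_term_def that)
  from this[of "{p. odd p}"] this[of "{p. even p}"]
  show ?thesis by (simp add: theta_ratio_def theta_odd_def theta_even_def)
qed

text \<open>The reflection u -> T/2 - u inverts the ratio and fixes T/4.\<close>

lemma theta_ratio_quarter: "theta_ratio T (T / 4) = 1"
proof -
  have "theta_ratio T (- (T/4) + T/2) = 1 / theta_ratio T (- (T/4))" by (rule theta_ratio_shift)
  hence "theta_ratio T (T/4) * theta_ratio T (T/4) = 1"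
    using theta_ratio_pos[of "T/4"] by (simp add: theta_ratio_minus field_simps)
  hence "theta_ratio T (T/4) = 1 \<or> theta_ratio T (T/4) = - 1" by (simp add: square_eq_1_iff)
  thus ?thesis using theta_ratio_pos[of "T/4"] by linarith
qed

lemma theta_ratio_half: "theta_ratio T (T / 2) = 1 / theta_ratio T 0"
  using theta_ratio_shift[of 0] by simp

text \<open>The case v = 0 of \<open>theta_num_mult\<close> writes the difference of the cross
  products as a square, so the minimum is located without derivatives.\<close>

lemma theta_ratio_ge: "theta_ratio T 0 \<le> theta_ratio T u"
proof -
  have "0 \<le> theta_num T (u + 0) * theta_num T (u - 0)" by simp
  hence "theta_even T u * theta_odd T 0 \<le> theta_odd T u * theta_even T 0"
    unfolding theta_num_mult[OF T] by simp
  thus ?thesis unfolding theta_ratio_def using theta_pos[OF T, of u] theta_pos[OF T, of 0]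
    by (simp add: field_simps)
qed

lemma theta_ratio_le: "theta_ratio T u \<le> 1 / theta_ratio T 0"
  using theta_ratio_shift[of "u - T/2"] theta_ratio_ge[of "u - T/2"] theta_ratio_pos[of 0]
    by (simp add: frac_le)

lemma theta_ratio_0_le: "theta_ratio T 0 \<le> 2 * exp (- T / 4)"
  using theta_odd_0_le[OF T] theta_pos[OF T, of 0] by (simp add: theta_ratio_def field_simps)

lemma theta_ratio_0_le_1: "theta_ratio T 0 \<le> 1"
  using theta_ratio_ge[of "T/4"] by (simp add: theta_ratio_quarter)

lemma continuous_on_theta_ratio: "continuous_on A (theta_ratio T)"
proof -
  have "theta_even T u \<noteq> 0" for u using theta_pos(1)[OF T, of u] by simp
  moreover have "continuous_on A (theta_even T)" "continuous_on A (theta_odd T)"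
    unfolding theta_even_def[abs_def] theta_odd_def[abs_def]
    by (rule continuous_on_subset[OF continuous_on_infsum_gauss_term[OF T]]; simp)+
  ultimately show ?thesis unfolding theta_ratio_def[abs_def] by (intro continuous_on_divide) auto
qed

lemma scaled_sn_half: "(scaled_sn T (T / 2))\<^sup>2 =
    (1 - (theta_ratio T 0)\<^sup>2) / (1 + (theta_ratio T 0)\<^sup>2)"
proof -
  have "scaled_sn T (T/2 + 0) * scaled_sn T (T/2 - 0) =
      \<bar>theta_ratio T (T/2) - theta_ratio T 0\<bar> / (theta_ratio T (T/2) + theta_ratio T 0)" by (rule
      scaled_sn_mult)
  also have "\<dots> = (1 / theta_ratio T 0 - theta_ratio T 0) / (1 / theta_ratio T 0 + theta_ratio T 0)"
    using theta_ratio_ge[of "T/2"] by (simp add: theta_ratio_half)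
  also have "\<dots> = (1 - (theta_ratio T 0)\<^sup>2) / (1 + (theta_ratio T 0)\<^sup>2)"
    using theta_ratio_pos[of 0] by (simp add: divide_simps power2_eq_square)
  finally show ?thesis by (simp add: power2_eq_square)
qed

text \<open>By periodicity the square of the value at w is the product of the values at u + T/2 and
  u - T/2 for u = w - T/2. The product rule turns it into (b - x) / (b + x), which decreases in x =
  X(u) and so is largest at the minimum u = 0 of X.\<close>

lemma scaled_sn_le: "scaled_sn T w \<le> scaled_sn T (T / 2)"
proof (rule power2_le_imp_le)
  define u where "u = w - T / 2"
  define a b x where "a = theta_ratio T 0" and "b = theta_ratio T (T/2)" and "x = theta_ratio T u"
  have o: "0 < a" "a \<le> x" "x \<le> b"
    using theta_ratio_pos[of 0] theta_ratio_ge[of u] theta_ratio_le[of u]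
      by (auto simp: a_def b_def x_def theta_ratio_half)
  have "(scaled_sn T w)\<^sup>2 = scaled_sn T (u + T/2) * scaled_sn T (u - T/2)"
    using scaled_sn_shift[of "u - T/2"] by (simp add: u_def power2_eq_square)
  also have "\<dots> = \<bar>x - b\<bar> / (x + b)" unfolding x_def b_def by (rule scaled_sn_mult)
  also have "\<dots> = (b - x) / (b + x)" using o by (simp add: add.commute)
  also have "\<dots> \<le> (b - a) / (b + a)" using o by (intro frac_le) auto
  also have "\<dots> = \<bar>b - a\<bar> / (b + a)" using o by simp
  also have "\<dots> = scaled_sn T (T/2 + 0) * scaled_sn T (T/2 - 0)"
    unfolding a_def b_def by (rule scaled_sn_mult[symmetric])
  finally show "(scaled_sn T w)\<^sup>2 \<le> (scaled_sn T (T / 2))\<^sup>2" by (simp add: power2_eq_square)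
qed (rule scaled_sn_nonneg)

lemma scaled_sn_limit: "(\<lambda>n. \<Prod>j<2*n. abs_tanh_half (w - (real j + 1 - real n) * T)) \<longlonglongrightarrow> scaled_sn T w"
  unfolding scaled_sn_def by (rule theta_product_limit[OF T])

end

section \<open>Refinement of the period and decay of the maximum\<close>

text \<open>The K translates of the lattice of spacing T fill the lattice of spacing T / K; division
  with remainder, i = l + K j, matches the factors. The offset (K - 1) T / K aligns the truncation
  windows, so the finite products already agree and only then is the limit taken.\<close>

lemma prod_scaled_sn:
  assumes T: "T > 0" and K: "K > 0"
  shows "(\<Prod>l<K. scaled_sn T (w - real l * (T / real K))) =
      scaled_sn (T / real K) (w - (real K - 1) * (T / real K))"
proof -
  define s where "s = T / real K"
  have s: "s > 0" using T K by (simp add: s_def)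
  have Ts: "T = real K * s" using K by (simp add: s_def)
  define P where "P n = (\<Prod>l<K. \<Prod>j<2*n. abs_tanh_half (w - real l * s - (real j + 1 - real n) *
      T))" for n
  have "P \<longlonglongrightarrow> (\<Prod>l<K. scaled_sn T (w - real l * s))"
    unfolding P_def by (intro tendsto_prod scaled_sn_limit[OF T])
  moreover have "P n = (\<Prod>i<2*(K*n). abs_tanh_half (w - (real K - 1) * s - (real i + 1 - real (K *
      n)) * s))" for n
  proof -
    have "P n = (\<Prod>(l,j)\<in>{..<K} \<times> {..<2*n}. abs_tanh_half (w - real l * s - (real j + 1 - real n) *
        T))"
      unfolding P_def by (rule prod.cartesian_product)
    also have "\<dots> = (\<Prod>i<2*(K*n). abs_tanh_half (w - (real K - 1) * s - (real i + 1 - real (K * n)) *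
        s))"
    proof (rule prod.reindex_bij_witness[where i = "\<lambda>i. (i mod K, i div K)" and j = "\<lambda>(l,j). l + K *
        j"])
      fix a assume a: "a \<in> {..<K} \<times> {..<2*n}"
      obtain l j where lj: "a = (l, j)" "l < K" "j < 2 * n" using a by auto
      show "((case a of (l, j) \<Rightarrow> l + K * j) mod K, (case a of (l, j) \<Rightarrow> l + K * j) div K) = a"
        using lj by auto
      have "l + K * j < K + K * j" using lj by simp
      also have "\<dots> = K * Suc j" by simp
      also have "\<dots> \<le> K * (2 * n)" using lj by (intro mult_left_mono) auto
      finally show "(case a of (l, j) \<Rightarrow> l + K * j) \<in> {..<2 * (K * n)}" using lj by simp
      show "abs_tanh_half (w - (real K - 1) * s - (real (case a of (l, j) \<Rightarrow> l + K * j) + 1 -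
          real (K * n)) * s) =
         (case a of (l, j) \<Rightarrow> abs_tanh_half (w - real l * s - (real j + 1 - real n) * T))"
        using lj by (simp add: Ts algebra_simps)
    next
      fix b assume b: "b \<in> {..<2 * (K * n)}"
      show "(case (b mod K, b div K) of (l, j) \<Rightarrow> l + K * j) = b" by simp
      show "(b mod K, b div K) \<in> {..<K} \<times> {..<2 * n}"
        using b K by (auto simp: less_mult_imp_div_less mult_ac)
    qed
    finally show ?thesis .
  qed
  moreover have "(\<lambda>n. \<Prod>i<2*(K*n). abs_tanh_half (w - (real K - 1) * s - (real i + 1 - real (K *
      n)) * s)) \<longlonglongrightarrow> scaled_sn s (w - (real K - 1) * s)"
    by (rule filterlim_compose[OF scaled_sn_limit[OF s]])
        (use K in \<open>simp add: mult_nat_left_at_top\<close>)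
  ultimately show ?thesis using LIMSEQ_unique unfolding s_def by (metis (no_types, lifting) ext)
qed

text \<open>Both sides are explicit in a = X(0): the square of the maximum is (1 - a^2) / (1 + a^2),
  and the maximum for half the period is (1 - a) / (1 + a). What remains is (1 + a)^2 <= 2 (1 +
  a^2).\<close>

lemma scaled_sn_landen: assumes T: "T > 0" shows "(scaled_sn T (T / 2))\<^sup>2 \<le>
    2 * scaled_sn (T / 2) (T / 2 / 2)"
proof -
  define a where "a = theta_ratio T 0"
  have a: "0 < a" "a \<le> 1"
    using theta_ratio_pos[OF T, of 0] theta_ratio_0_le_1[OF T] by (auto simp: a_def)
  \<comment> \<open>The start 3T/4 absorbs the offset T/2 of the refinement rule. The two factors,
    at 3T/4 and T/4, have the form u + v and u - v with u = T/2 and v = T/4, where X(v) = 1.\<close>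
  have "scaled_sn (T/2) (T/2/2) = (\<Prod>l<2. scaled_sn T (3*T/4 - real l * (T / real 2)))"
    by (subst prod_scaled_sn[OF T]) (auto simp: field_simps)
  also have "\<dots> = scaled_sn T (T/2 + T/4) * scaled_sn T (T/2 - T/4)"
    by (simp add: numeral_2_eq_2 field_simps)
  also have "\<dots> = (1 / a - 1) / (1 / a + 1)"
    unfolding scaled_sn_mult[OF T] theta_ratio_half[OF T] theta_ratio_quarter[OF T] a_def[symmetric]
      using a by simp
  also have "\<dots> = (1 - a) / (1 + a)" using a by (simp add: divide_simps)
  finally have 1: "scaled_sn (T/2) (T/2/2) = (1 - a) / (1 + a)" .
  have "(1 + a)\<^sup>2 \<le> 2 * (1 + a\<^sup>2)"
    using zero_le_power2[of "1 - a"] by (simp add: power2_eq_square algebra_simps)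
  hence "(1 - a) * (1 + a)\<^sup>2 \<le> (1 - a) * (2 * (1 + a\<^sup>2))" using a by (intro mult_left_mono) auto
  hence "(1 - a\<^sup>2) * (1 + a) \<le> (2 * (1 - a)) * (1 + a\<^sup>2)"
    by (simp add: power2_eq_square algebra_simps)
  moreover have "1 + a\<^sup>2 > 0" by (simp add: add_pos_nonneg)
  ultimately have "(1 - a\<^sup>2) / (1 + a\<^sup>2) \<le> 2 * ((1 - a) / (1 + a))"
    using a by (simp add: divide_simps)
  thus ?thesis unfolding scaled_sn_half[OF T] 1 a_def .
qed

text \<open>With z = exp (-y), the logarithm of tanh (y/2) is -2 times the sum of z^(2j+1) / (2j+1),
  and truncating a series of negative terms gives an upper bound. The proof differentiates: partial
  sums of the geometric series in x^2 stay below 1 / (1 - x^2).\<close>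

lemma abs_tanh_half_le:
  assumes "y > 0" shows "abs_tanh_half y \<le>
      exp (- 2 * (\<Sum>j<N. exp (- (2 * real j + 1) * y) / (2 * real j + 1)))"
proof -
  define z where "z = exp (- y)"
  have z: "0 < z" "z < 1" using assms by (auto simp: z_def)
  have zp: "exp (- (2 * real j + 1) * y) = z ^ (2 * j + 1)" for j
    unfolding z_def exp_of_nat_mult[symmetric] by (simp add: algebra_simps)
  have "abs_tanh_half y = (1 - z) / (1 + z)"
    using assms by (simp add: abs_tanh_half_def z_def exp_minus divide_simps)
  define g where "g x = ln (1 - x) - ln (1 + x) + 2 * (\<Sum>j<N. x ^ (2 * j + 1) / (2 * real j +
      1))" for x :: real
  have "g z \<le> g 0"
  proof (rule DERIV_nonpos_imp_nonincreasing[of 0 z g])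
    fix x assume x: "0 \<le> x" "x \<le> z"
    have x1: "x < 1" using x z by simp
    have x2: "x\<^sup>2 < 1" using x x1 by (simp add: power_less_one_iff abs_square_less_1)
    have nz: "2 * real j + 1 \<noteq> 0" for j by linarith
    have d': "((\<lambda>x. x ^ (2 * j + 1) / (2 * real j + 1)) has_real_derivative x ^ (2 *
        j)) (at x)" for j
    proof -
      have "((\<lambda>x. x ^ (2 * j + 1)) has_real_derivative real (2 * j + 1) * x ^ (2 * j)) (at x)"
        using DERIV_pow[of "2 * j + 1" x] by simp
      from DERIV_cdivide[OF this, of "2 * real j + 1"] show ?thesis
        using nz[of j] by (simp add: add.commute[of 1])
    qed
    have d: "(g has_real_derivative (- 1 / (1 - x) - 1 / (1 + x) + 2 * (\<Sum>j<N. x ^ (2 * j)))) (at x)"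
      unfolding g_def
        by (rule derivative_eq_intros d'[unfolded Suc_eq_plus1] refl | use x x1 in force)+
          (use nz in \<open>simp add: add.commute[of 1]\<close>)
    have "(\<Sum>j<N. x ^ (2 * j)) \<le> 1 / (1 - x\<^sup>2)"
    proof -
      have "(\<Sum>j<N. x ^ (2 * j)) = (1 - (x\<^sup>2) ^ N) / (1 - x\<^sup>2)"
        using x2 by (simp add: power_mult sum_gp_strict)
      thus ?thesis using x2 x by (auto intro!: divide_right_mono)
    qed
    moreover have "- 1 / (1 - x) - 1 / (1 + x) = - 2 * (1 / (1 - x\<^sup>2))"
      using x x1 x2 by (simp add: divide_simps) (simp add: power2_eq_square algebra_simps)
    ultimately show "\<exists>y. (g has_real_derivative y) (at x) \<and> y \<le> 0" using d by (intro exI conjI) auto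
  qed (use z in auto)
  hence "ln (1 - z) - ln (1 + z) \<le> - 2 * (\<Sum>j<N. z ^ (2 * j + 1) / (2 * real j + 1))"
    by (simp add: g_def)
  hence "ln ((1 - z) / (1 + z)) \<le> - 2 * (\<Sum>j<N. z ^ (2 * j + 1) / (2 * real j + 1))"
    using z by (simp add: ln_div)
  hence "(1 - z) / (1 + z) \<le> exp (- 2 * (\<Sum>j<N. z ^ (2 * j + 1) / (2 * real j + 1)))"
    using z by (subst (asm) exp_le_cancel_iff[symmetric]) simp
  thus ?thesis unfolding \<open>abs_tanh_half y = _\<close> zp .
qed

lemma abs_tanh_half_minus: "abs_tanh_half (- y) = abs_tanh_half y"
proof -
  have "1 - exp (-y) = - exp (-y) * (1 - exp y)" "1 + exp (-y) = exp (-y) * (1 + exp y)"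
    by (simp_all add: algebra_simps flip: exp_add)
  thus ?thesis unfolding abs_tanh_half_def by (simp add: abs_mult)
qed

lemma abs_tanh_half_nonneg: "abs_tanh_half y \<ge> 0" by (simp add: abs_tanh_half_def add_nonneg_nonneg)

text \<open>At half a period every distance (m + 1/2) s to the lattice occurs twice. Inserting the
  truncated series for ln tanh makes the sum over m geometric, and 1 - exp (-c) <= c then produces
  the factor 4 / s. Truncation at N keeps the later limit s -> 0 termwise.\<close>

lemma scaled_sn_half_bound:
  assumes s: "s > 0"
  shows "scaled_sn s (s / 2) \<le> exp (- (4 / s) * (\<Sum>j<N. exp (- (2 * real j + 1) * s / 2) / (2 *
      real j + 1)\<^sup>2))"
proof -
  define B where "B n = exp (- 4 * (\<Sum>j<N. (1 / (2 * real j + 1)) * (\<Sum>m<n. exp (- ((2 * real j + 1) *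
      s)) ^ m * exp (- (2 * real j + 1) * s / 2))))" for n
  have B: "(\<Prod>j<2*n. abs_tanh_half (s / 2 - (real j + 1 - real n) * s)) \<le> B n" for n
  proof -
    define t where "t m = abs_tanh_half ((real m + 1/2) * s)" for m
    \<comment> \<open>The first n factors have positive arguments and the last n their negatives;
      \<open>abs_tanh_half\<close> is even.\<close>
    have "{..<2*n} = {..<n} \<union> {n..<2*n}" by auto
    hence "(\<Prod>j<2*n. abs_tanh_half (s / 2 - (real j + 1 - real n) * s)) =
       (\<Prod>j<n. abs_tanh_half (s / 2 - (real j + 1 - real n) * s)) * (\<Prod>j\<in>{n..<2*n}. abs_tanh_half (s /
           2 - (real j + 1 - real n) * s))"
      by (simp add: prod.union_disjoint ivl_disj_int)
    also have "(\<Prod>j<n. abs_tanh_half (s / 2 - (real j + 1 - real n) * s)) = (\<Prod>m<n. t m)"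
      by (rule prod.reindex_bij_witness[where i = "\<lambda>m. n - 1 - m" and j = "\<lambda>m. n - 1 - m"])
         (auto simp: t_def of_nat_diff algebra_simps)
    also have "(\<Prod>j\<in>{n..<2*n}. abs_tanh_half (s / 2 - (real j + 1 - real n) * s)) = (\<Prod>m<n. t m)"
    proof (rule prod.reindex_bij_witness[where i = "\<lambda>m. n + m" and j = "\<lambda>m. m - n"])
      fix j assume "j \<in> {n..<2*n}"
      hence "(real (j - n) + 1/2) * s = - (s / 2 - (real j + 1 - real n) * s)"
        by (simp add: algebra_simps of_nat_diff)
      thus "t (j - n) = abs_tanh_half (s / 2 - (real j + 1 - real n) * s)"
        unfolding t_def by (simp only: abs_tanh_half_minus)
    qed auto
    also have "(\<Prod>m<n. t m) * (\<Prod>m<n. t m) = (\<Prod>m<n. (t m)\<^sup>2)"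
      by (simp add: power2_eq_square prod.distrib)
    also have "\<dots> \<le> (\<Prod>m<n. exp (- 4 * (\<Sum>j<N. exp (- (2 * real j + 1) * ((real m + 1/2) * s)) / (2 *
        real j + 1))))"
    proof (intro prod_mono conjI)
      fix m
      let ?S = "\<Sum>j<N. exp (- (2 * real j + 1) * ((real m + 1/2) * s)) / (2 * real j + 1)"
      have "(t m)\<^sup>2 \<le> (exp (- 2 * ?S))\<^sup>2"
        unfolding t_def
          using s
          by (intro power_mono abs_tanh_half_le abs_tanh_half_nonneg) (simp add: add_nonneg_pos)
      thus "(t m)\<^sup>2 \<le> exp (- 4 * ?S)" by (simp add: power2_eq_square mult_exp_exp)
    qed auto
    also have "\<dots> = exp (- 4 * (\<Sum>m<n. \<Sum>j<N. exp (- (2 * real j + 1) * ((real m + 1/2) * s)) / (2 *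
        real j + 1)))"
      by (simp add: exp_sum sum_distrib_left)
    also have "(\<Sum>m<n. \<Sum>j<N. exp (- (2 * real j + 1) * ((real m + 1/2) * s)) / (2 * real j + 1)) =
       (\<Sum>j<N. (1 / (2 * real j + 1)) * (\<Sum>m<n. exp (- ((2 * real j + 1) * s)) ^ m * exp (- (2 * real
           j + 1) * s / 2)))"
      unfolding sum_distrib_left
      by (subst sum.swap, intro sum.cong refl)
         (simp add: exp_of_nat_mult[symmetric] mult_exp_exp algebra_simps add_divide_distrib)
    finally show ?thesis unfolding B_def .
  qed
  have "B \<longlonglongrightarrow> exp (- 4 * (\<Sum>j<N. (1 / (2 * real j + 1)) * (1 / (1 - exp (- ((2 * real j + 1) * s))) *
      exp (- (2 * real j + 1) * s / 2))))"
    unfolding B_def sum_distrib_right[symmetric]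
    by (intro tendsto_intros geometric_sums[unfolded sums_def])
        (use s in \<open>simp add: mult_pos_pos add_nonneg_pos\<close>)
  hence "scaled_sn s (s / 2) \<le> exp (- 4 * (\<Sum>j<N. (1 / (2 * real j + 1)) * (1 / (1 - exp (- ((2 *
      real j + 1) * s))) * exp (- (2 * real j + 1) * s / 2))))"
    using B by (intro LIMSEQ_le[OF scaled_sn_limit[OF s]]) auto
  also have "\<dots> \<le> exp (- (4 / s) * (\<Sum>j<N. exp (- (2 * real j + 1) * s / 2) / (2 * real j + 1)\<^sup>2))"
  proof -
    have "(1 / s) * (exp (- (2 * real j + 1) * s / 2) / (2 * real j + 1)\<^sup>2) \<le>
      (1 / (2 * real j + 1)) * (1 / (1 - exp (- ((2 * real j + 1) * s))) * exp (- (2 * real j + 1) *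
          s / 2))" for j
    proof -
      define c where "c = (2 * real j + 1) * s"
      have c: "c > 0" unfolding c_def using s by (simp add: add_nonneg_pos)
      have "1 + (- c) \<le> exp (- c)" by (rule exp_ge_add_one_self)
      hence "1 / c \<le> 1 / (1 - exp (- c))" using c by (intro frac_le) auto
      hence "(1 / (2 * real j + 1)) * (1 / c * exp (- (2 * real j + 1) * s / 2)) \<le>
         (1 / (2 * real j + 1)) * (1 / (1 - exp (- c)) * exp (- (2 * real j + 1) * s / 2))"
        by (intro mult_left_mono mult_right_mono) auto
      thus ?thesis unfolding c_def by (simp add: power2_eq_square mult_ac)
    qed
    hence "(\<Sum>j<N. (1 / s) * (exp (- (2 * real j + 1) * s / 2) / (2 * real j + 1)\<^sup>2)) \<le>
      (\<Sum>j<N. (1 / (2 * real j + 1)) * (1 / (1 - exp (- ((2 * real j + 1) * s))) * exp (- (2 * real j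
          + 1) * s / 2)))"
      by (intro sum_mono)
    thus ?thesis unfolding sum_distrib_left[symmetric] by simp
  qed
  finally show ?thesis .
qed

text \<open>Group the Basel series in pairs and subtract the even squares, which make up a quarter
  of it.\<close>

lemma inverse_odd_squares_sums: "(\<lambda>j. 1 / (2 * real j + 1)\<^sup>2) sums (pi\<^sup>2 / 8)"
proof -
  have "(\<lambda>n. sum (\<lambda>n. 1 / (real n + 1)\<^sup>2) {n * 2..<n * 2 + 2}) sums (pi\<^sup>2 / 6)"
    using sums_group[OF inverse_squares_sums, of 2] by (simp add: add.commute)
  moreover have "(\<lambda>n. (1/4) * (1 / (real n + 1)\<^sup>2)) sums ((1/4) * (pi\<^sup>2 / 6))"
    using inverse_squares_sums by (intro sums_mult) (simp add: add.commute)
  ultimately have "(\<lambda>n. sum (\<lambda>n. 1 / (real n + 1)\<^sup>2) {n * 2..<n * 2 + 2} - (1/4) * (1 / (real n +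
      1)\<^sup>2)) sums (pi\<^sup>2 / 6 - (1/4) * (pi\<^sup>2 / 6))"
    by (rule sums_diff)
  moreover have "sum (\<lambda>n. 1 / (real n + 1)\<^sup>2) {n * 2..<n * 2 + 2} - (1/4) * (1 / (real n + 1)\<^sup>2) =
      1 / (2 * real n + 1)\<^sup>2" for n
  proof -
    have "{n * 2..<n * 2 + 2} = {2 * n, 2 * n + 1}" by auto
    moreover have "(2 * real n + 1 + 1)\<^sup>2 = 4 * (real n + 1)\<^sup>2"
      by (simp add: power2_eq_square algebra_simps)
    ultimately show ?thesis by simp
  qed
  ultimately show ?thesis by simp
qed

text \<open>For F(T) = T (ln f(T) - ln 2) the Landen inequality reads F(T) <= F(T/2), while the
  bound for small periods forces F down to -pi^2 / 2 in the limit. Arguing by contradiction also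
  supplies the positivity that the logarithms require.\<close>

lemma scaled_sn_half_le: assumes T: "T > 0" shows "scaled_sn T (T / 2) \<le> 2 * exp (- pi\<^sup>2 / (2 * T))"
proof (rule ccontr)
  assume "\<not> ?thesis"
  hence gt: "2 * exp (- pi\<^sup>2 / (2 * T)) < scaled_sn T (T / 2)" by simp
  hence f0: "scaled_sn T (T/2) > 0" by (rule less_trans[rotated]) simp
  \<comment> \<open>The excess of ln f(T) over the claimed bound. Each halving of the period at
    least doubles it.\<close>
  define c where "c = ln (scaled_sn T (T/2)) + pi\<^sup>2 / (2 * T) - ln 2"
  have "ln (2 * exp (- pi\<^sup>2 / (2 * T))) < ln (scaled_sn T (T/2))"
    using gt f0 by (subst ln_less_cancel_iff) auto
  hence c: "c > 0" unfolding c_def by (simp add: ln_mult)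
  have iter: "scaled_sn (T / 2^n) (T / 2^n / 2) > 0 \<and> 2 ^ n * (c - pi\<^sup>2 / (2 * T)) + ln 2 \<le>
      ln (scaled_sn (T / 2^n) (T / 2^n / 2))" for n
  proof (induction n)
    case 0
    thus ?case using f0 by (simp add: c_def)
  next
    case (Suc n)
    define f where "f = scaled_sn (T / 2^n) (T / 2^n / 2)"
    define f' where "f' = scaled_sn (T / 2^Suc n) (T / 2^Suc n / 2)"
    have f: "f > 0" "2 ^ n * (c - pi\<^sup>2 / (2 * T)) + ln 2 \<le> ln f" using Suc by (auto simp: f_def)
    have le: "f\<^sup>2 \<le> 2 * f'"
      using scaled_sn_landen[of "T / 2^n"] T by (simp add: f_def f'_def mult.commute)
    have f': "f' > 0" using f(1) le by (smt (verit) zero_less_power2)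
    have "ln (f\<^sup>2) \<le> ln (2 * f')" using le f(1) f' by (subst ln_le_cancel_iff) auto
    hence "2 * ln f \<le> ln 2 + ln f'" using f(1) f' by (simp add: ln_mult ln_realpow)
    moreover have "2 * 2 ^ n * (c - pi\<^sup>2 / (2 * T)) + 2 * ln 2 \<le> 2 * ln f" using f(2) by linarith
    ultimately have "2 ^ Suc n * (c - pi\<^sup>2 / (2 * T)) + ln 2 \<le> ln f'" by simp
    thus ?case using f' unfolding f'_def by blast
  qed
  \<comment> \<open>The number of halvings tends to infinity first, with N fixed, so that the
    finitely many exponentials tend to 1. Only afterwards does N grow, and 4 / T times pi^2 / 8 is
    exactly the rate pi^2 / (2T).\<close>
  have fin: "c - pi\<^sup>2 / (2 * T) \<le> - (4 / T) * (\<Sum>j<N. 1 / (2 * real j + 1)\<^sup>2)" for N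
  proof -
    have "c - pi\<^sup>2 / (2 * T) \<le> - (4 / T) * (\<Sum>j<N. exp (- (2 * real j + 1) * (T / 2 ^ n) / 2) / (2 *
        real j + 1)\<^sup>2)" (is "_ \<le> - (4 / T) * ?S") for n
    proof -
      have "2 ^ n * (c - pi\<^sup>2 / (2 * T)) \<le> ln (scaled_sn (T / 2^n) (T / 2^n / 2))"
        using iter[of n] ln_gt_zero[of 2] by linarith
      also have "\<dots> \<le> ln (exp (- (4 / (T / 2^n)) * ?S))"
        using iter[of n] scaled_sn_half_bound[of "T / 2^n" N] T by (subst ln_le_cancel_iff) auto
      also have "\<dots> = 2 ^ n * (- (4 / T) * ?S)" by simp
      finally show ?thesis by (rule mult_left_le_imp_le) simp
    qed
    moreover have "(\<lambda>n. - (4 / T) * (\<Sum>j<N. exp (- (2 * real j + 1) * (T / 2 ^ n) / 2) / (2 *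
        real j + 1)\<^sup>2)) \<longlonglongrightarrow>
       - (4 / T) * (\<Sum>j<N. exp (- (2 * real j + 1) * 0 / 2) / (2 * real j + 1)\<^sup>2)"
    proof -
      have "2 * real j + 1 > 0" for j by (simp add: add_nonneg_pos)
      moreover have "(\<lambda>n. T * (1 / 2) ^ n) \<longlonglongrightarrow> T * 0"
        by (intro tendsto_intros LIMSEQ_realpow_zero) auto
      hence "(\<lambda>n. T / 2 ^ n) \<longlonglongrightarrow> 0" by (simp add: power_one_over field_simps)
      ultimately show ?thesis by (intro tendsto_intros) (auto simp: less_le)
    qed
    ultimately show ?thesis
      by (intro LIMSEQ_le_const[of "\<lambda>n. - (4 / T) * (\<Sum>j<N. exp (- (2 * real j + 1) * (T / 2 ^ n) /
        2) / (2 * real j + 1)\<^sup>2)"]) auto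
  qed
  have "(\<lambda>N. - (4 / T) * (\<Sum>j<N. 1 / (2 * real j + 1)\<^sup>2)) \<longlonglongrightarrow> - (4 / T) * (pi\<^sup>2 / 8)"
    using inverse_odd_squares_sums by (intro tendsto_intros) (simp add: sums_def)
  hence "c - pi\<^sup>2 / (2 * T) \<le> - (4 / T) * (pi\<^sup>2 / 8)" using fin by (intro LIMSEQ_le_const) auto
  thus False using c T by simp
qed

theorem zolotarev_bound:
  fixes M :: real
  assumes M: "M \<ge> 1" and k: "k > 0"
  obtains y :: "nat \<Rightarrow> real" where "\<And>i. y i > 0"
    "\<And>x. 1 / (2 * M) \<le> x \<Longrightarrow> x \<le> 2 * M \<Longrightarrow>
       \<bar>\<Prod>i<k. (x - y i) / (x + y i)\<bar> \<le> 2 * exp (- pi\<^sup>2 * real k / (4 * ln (4 * M)))"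
proof -
  \<comment> \<open>With this period the bound 2 exp (-T/4) on X(0) equals 1 / (2M), so X takes
    every value of [1/(2M), 2M] on [0, T/2].\<close>
  define T where "T = 4 * ln (4 * M)"
  have T: "T > 0" using M by (simp add: T_def)
  define s where "s = T / real (2 * k)"
  have s: "s > 0" using T k by (simp add: s_def)
  define y where "y i = theta_ratio T ((real i + 1/2) * s)" for i
  have "\<bar>\<Prod>i<k. (x - y i) / (x + y i)\<bar> \<le> 2 * exp (- pi\<^sup>2 * real k / (4 * ln (4 * M)))"
    if x: "1 / (2 * M) \<le> x" "x \<le> 2 * M" for x
  proof -
    have "theta_ratio T 0 \<le> 2 * exp (- T / 4)" by (rule theta_ratio_0_le[OF T])
    also have "\<dots> = 1 / (2 * M)" using M by (simp add: T_def exp_minus field_simps)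
    finally have X0: "theta_ratio T 0 \<le> 1 / (2 * M)" .
    hence "theta_ratio T 0 \<le> x" using x by simp
    moreover have "2 * M \<le> theta_ratio T (T / 2)"
      using X0 theta_ratio_pos[OF T, of 0] M
      unfolding theta_ratio_half[OF T] by (simp add: field_simps)
    hence "x \<le> theta_ratio T (T / 2)" using x by simp
    ultimately obtain u where u: "theta_ratio T u = x"
      using IVT'[of "theta_ratio T" 0 x "T / 2"] continuous_on_theta_ratio[OF T] T by auto
    have xp: "x > 0" using u theta_ratio_pos[OF T, of u] by simp
    \<comment> \<open>The arguments u + (i + 1/2) s and u - (i + 1/2) s for i < k form a single
      arithmetic progression of 2k points with step s, listed here from the largest. Its total
      length 2 k s is one period T, so the refinement rule applies.\<close>
    let ?g = "\<lambda>l. scaled_sn T (u + (real k - 1/2) * s - real l * s)"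
    have "\<bar>\<Prod>i<k. (x - y i) / (x + y i)\<bar> = (\<Prod>i<k. \<bar>x - y i\<bar> / (x + y i))"
      unfolding abs_prod y_def abs_divide using xp theta_ratio_pos[OF T]
      by (intro prod.cong refl arg_cong2[where f = "(/)"] abs_of_pos add_pos_pos)
    also have "\<dots> = (\<Prod>i<k. scaled_sn T (u + (real i + 1/2) * s) * scaled_sn T (u - (real i + 1/2) *
        s))"
      unfolding y_def u[symmetric] scaled_sn_mult[OF T] ..
    also have "\<dots> = (\<Prod>i<k. scaled_sn T (u + (real i + 1/2) * s)) * (\<Prod>i<k. scaled_sn T (u - (real i +
        1/2) * s))"
      by (rule prod.distrib)
    also have "(\<Prod>i<k. scaled_sn T (u + (real i + 1/2) * s)) = prod ?g {..<k}"
      by (rule prod.reindex_bij_witness[where i = "\<lambda>m. k - 1 - m" and j = "\<lambda>m. k - 1 - m"])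
         (auto simp: of_nat_diff algebra_simps)
    also have "(\<Prod>i<k. scaled_sn T (u - (real i + 1/2) * s)) = prod ?g {k..<2*k}"
      by (rule prod.reindex_bij_witness[where i = "\<lambda>m. m - k" and j = "\<lambda>m. m + k"])
         (auto simp: of_nat_diff algebra_simps)
    also have "prod ?g {..<k} * prod ?g {k..<2*k} = prod ?g {..<2*k}"
    proof -
      have "{..<2*k} = {..<k} \<union> {k..<2*k}" by auto
      thus ?thesis by (simp add: prod.union_disjoint ivl_disj_int)
    qed
    also have "\<dots> = scaled_sn s (u + (real k - 1/2) * s - (real (2*k) - 1) * s)"
      unfolding s_def by (rule prod_scaled_sn[OF T]) (use k in auto)
    also have "\<dots> \<le> scaled_sn s (s / 2)" by (rule scaled_sn_le[OF s])
    also have "\<dots> \<le> 2 * exp (- pi\<^sup>2 / (2 * s))" by (rule scaled_sn_half_le[OF s])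
    also have "- pi\<^sup>2 / (2 * s) = - pi\<^sup>2 * real k / T" using k T by (simp add: s_def field_simps)
    finally show ?thesis unfolding T_def .
  qed
  thus ?thesis using that[of y] theta_ratio_pos[OF T] by (simp add: y_def)
qed

section \<open>Arcs of the unit circle\<close>

text \<open>Concavity of the sine on [0, pi] along the chord from 0 to x. Clearing denominators
  admits x = 0.\<close>

lemma sin_scaled_le:
  fixes x y :: real
  assumes "0 \<le> y" "y \<le> x" "x \<le> pi"
  shows "y * sin x \<le> x * sin y"
proof (cases "x = 0")
  case True
  thus ?thesis using assms by simp
next
  case False
  hence x: "x > 0" using assms by simp
  have "convex_on {0..pi} (\<lambda>x. - sin x :: real)"
    by (rule f''_ge0_imp_convex[where f' = "\<lambda>x. - cos x" and f'' = sin])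
       (auto intro!: derivative_eq_intros sin_ge_zero)
  from convex_onD[OF this, of "y / x" 0 x] have "y / x * sin x \<le> sin y"
    using assms x by (simp add: divide_simps)
  thus ?thesis using x by (simp add: field_simps)
qed

text \<open>The quotient of the sum and the difference of the tangents is sin (\<alpha> + \<beta>) /
  sin (\<beta> - \<alpha>), and concavity of the sine bounds it by the quotient of the
  angles.\<close>

lemma tan_sum_diff_ratio:
  assumes ab: "0 < \<alpha>" "\<alpha> < \<beta>" "\<alpha> + \<beta> \<le> pi / 2" and M: "\<alpha> + \<beta> \<le> M * (\<beta> - \<alpha>)"
  shows "tan \<alpha> + tan \<beta> \<le> M * (tan \<beta> - tan \<alpha>)"
proof -
  have c: "cos \<alpha> > 0" "cos \<beta> > 0" using ab by (auto intro!: cos_gt_zero)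
  have sp: "sin (\<beta> - \<alpha>) \<ge> 0" using ab pi_gt_zero by (intro sin_ge_zero) linarith+
  have "(\<beta> - \<alpha>) * sin (\<alpha> + \<beta>) \<le> (\<alpha> + \<beta>) * sin (\<beta> - \<alpha>)"
    using ab pi_gt_zero by (intro sin_scaled_le) linarith+
  also have "\<dots> \<le> M * (\<beta> - \<alpha>) * sin (\<beta> - \<alpha>)" using M sp by (intro mult_right_mono)
  finally have "(\<beta> - \<alpha>) * sin (\<alpha> + \<beta>) \<le> (\<beta> - \<alpha>) * (M * sin (\<beta> - \<alpha>))" by (simp add: mult_ac)
  hence *: "sin (\<alpha> + \<beta>) \<le> M * sin (\<beta> - \<alpha>)" using ab by simp
  have "(tan \<alpha> + tan \<beta>) * (cos \<alpha> * cos \<beta>) = sin (\<alpha> + \<beta>)"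
       "(tan \<beta> - tan \<alpha>) * (cos \<alpha> * cos \<beta>) = sin (\<beta> - \<alpha>)"
    using c by (simp_all add: tan_def sin_add sin_diff field_simps)
  with * have "(tan \<alpha> + tan \<beta>) * (cos \<alpha> * cos \<beta>) \<le> (M * (tan \<beta> - tan \<alpha>)) * (cos \<alpha> * cos \<beta>)"
    by (simp add: mult.assoc)
  thus ?thesis using c by simp
qed

text \<open>In terms of t = tan \<phi> the map is (g + t) / (g - t); sines and cosines keep it
  meaningful where the tangent is infinite. The choice g^2 = tan \<alpha> tan \<beta> makes t -> g^2
  / t exchange the two arcs while negating the image, so both have the same extreme quotient (q + p)
  / (q - p), where p^2 = tan \<alpha> and q^2 = tan \<beta>.\<close>

lemma moebius_arcs:
  assumes ab: "0 < \<alpha>" "\<alpha> < \<beta>" "\<alpha> + \<beta> \<le> pi / 2" and M: "\<alpha> + \<beta> \<le> M * (\<beta> - \<alpha>)" "M \<ge> 1"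
  obtains g where "g > 0"
    "\<And>\<phi>. \<bar>\<phi>\<bar> \<le> \<alpha> \<Longrightarrow> g * cos \<phi> - sin \<phi> \<noteq> 0 \<and>
       1 / (2 * M) \<le> (g * cos \<phi> + sin \<phi>) / (g * cos \<phi> - sin \<phi>) \<and>
       (g * cos \<phi> + sin \<phi>) / (g * cos \<phi> - sin \<phi>) \<le> 2 * M"
    "\<And>\<phi>. \<beta> \<le> \<bar>\<phi>\<bar> \<Longrightarrow> \<bar>\<phi>\<bar> \<le> pi - \<beta> \<Longrightarrow> g * cos \<phi> - sin \<phi> \<noteq> 0 \<and>
       1 / (2 * M) \<le> - ((g * cos \<phi> + sin \<phi>) / (g * cos \<phi> - sin \<phi>)) \<and>
       - ((g * cos \<phi> + sin \<phi>) / (g * cos \<phi> - sin \<phi>)) \<le> 2 * M"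
proof -
  define p q where "p = sqrt (tan \<alpha>)" and "q = sqrt (tan \<beta>)"
  have b2: "\<beta> < pi / 2" "\<alpha> < pi / 2" using ab by linarith+
  have t: "0 < tan \<alpha>" "tan \<alpha> < tan \<beta>" using ab b2 by (auto intro!: tan_gt_zero tan_monotone)
  have pq: "0 < p" "p < q" "tan \<alpha> = p\<^sup>2" "tan \<beta> = q\<^sup>2" using t by (auto simp: p_def q_def)
  define g where "g = p * q"
  have g: "g > 0" using pq by (simp add: g_def)
  have key: "(2 * M + 1) * p \<le> (2 * M - 1) * q"
  proof -
    have "p\<^sup>2 + q\<^sup>2 \<le> M * (q\<^sup>2 - p\<^sup>2)" using tan_sum_diff_ratio[OF ab M(1)] pq by simp
    moreover have "(p + q)\<^sup>2 \<le> 2 * (p\<^sup>2 + q\<^sup>2)"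
      using zero_le_power2[of "p - q"] by (simp add: power2_eq_square algebra_simps)
    ultimately have "(p + q) * (p + q) \<le> (2 * M * (q - p)) * (p + q)"
      by (simp add: power2_eq_square algebra_simps)
    hence "p + q \<le> 2 * M * (q - p)" using pq by simp
    thus ?thesis by (simp add: algebra_simps)
  qed
  have k1: "(2 * M + 1) * p\<^sup>2 \<le> (2 * M - 1) * g"
    using mult_right_mono[OF key, of p] pq by (simp add: g_def power2_eq_square algebra_simps)
  have k2: "(2 * M + 1) * g \<le> (2 * M - 1) * q\<^sup>2"
    using mult_right_mono[OF key, of q] pq by (simp add: g_def power2_eq_square algebra_simps)
  have cab: "cos \<alpha> > 0" "cos \<beta> > 0" using ab b2 by (auto intro!: cos_gt_zero)
  have sa: "sin \<alpha> = p\<^sup>2 * cos \<alpha>" "sin \<beta> = q\<^sup>2 * cos \<beta>"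
    using cab pq(3,4) by (auto simp: tan_def field_simps)
  \<comment> \<open>For t = s / c the hypothesis says |t| <= g (2M - 1) / (2M + 1), which is
    equivalent to (g + t) / (g - t) lying in [1/(2M), 2M]. Free c and s let the same computation
    serve both arcs.\<close>
  have ratio: "g * c - s \<noteq> 0 \<and> 1 / (2 * M) \<le> (g * c + s) / (g * c - s) \<and> (g * c + s) / (g * c - s) \<le>
      2 * M"
    if c: "c > 0" and s: "(2 * M + 1) * \<bar>s\<bar> \<le> (2 * M - 1) * (g * c)" for c s
  proof -
    have gc: "g * c > 0" using g c by simp
    have "(2 * M - 1) * (g * c) < (2 * M + 1) * (g * c)"
      using gc by (intro mult_strict_right_mono) auto
    hence "(2 * M + 1) * \<bar>s\<bar> < (2 * M + 1) * (g * c)" using s by linarith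
    hence d: "g * c - s > 0" "g * c + s > 0" using M(2) by auto
    have "(2 * M + 1) * s \<le> (2 * M - 1) * (g * c)" "(2 * M + 1) * (- s) \<le> (2 * M - 1) * (g * c)"
      using s M(2) mult_left_mono[of s "\<bar>s\<bar>" "2 * M + 1"] mult_left_mono[of "-s" "\<bar>s\<bar>" "2 * M + 1"]
        by linarith+
    hence "g * c + s \<le> 2 * M * (g * c - s)" "g * c - s \<le> (g * c + s) * (2 * M)"
      by (simp_all add: algebra_simps)
    thus ?thesis using d M(2) by (simp add: divide_simps)
  qed
  show ?thesis
  proof (rule that[OF g])
    fix \<phi> :: real assume \<phi>: "\<bar>\<phi>\<bar> \<le> \<alpha>"
    have c: "cos \<phi> > 0" using \<phi> b2 by (intro cos_gt_zero_pi) linarith+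
    have "0 \<le> sin (\<alpha> - \<phi>)" "0 \<le> sin (\<alpha> + \<phi>)" using \<phi> b2 pi_gt_zero by (intro sin_ge_zero; linarith)+
    hence "cos \<alpha> * sin \<phi> \<le> cos \<alpha> * (p\<^sup>2 * cos \<phi>)" "cos \<alpha> * (- sin \<phi>) \<le> cos \<alpha> * (p\<^sup>2 * cos \<phi>)"
      by (simp_all add: sin_add sin_diff sa algebra_simps)
    hence "sin \<phi> \<le> p\<^sup>2 * cos \<phi>" "- sin \<phi> \<le> p\<^sup>2 * cos \<phi>"
      using cab(1) by (metis mult_le_cancel_left_pos)+
    hence "\<bar>sin \<phi>\<bar> \<le> p\<^sup>2 * cos \<phi>" by linarith
    hence "(2 * M + 1) * \<bar>sin \<phi>\<bar> \<le> (2 * M + 1) * (p\<^sup>2 * cos \<phi>)"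
      using M(2) by (intro mult_left_mono) auto
    also have "\<dots> \<le> (2 * M - 1) * (g * cos \<phi>)"
      using mult_right_mono[OF k1, of "cos \<phi>"] c by (simp add: mult.assoc)
    finally show "g * cos \<phi> - sin \<phi> \<noteq> 0 \<and>
       1 / (2 * M) \<le> (g * cos \<phi> + sin \<phi>) / (g * cos \<phi> - sin \<phi>) \<and>
       (g * cos \<phi> + sin \<phi>) / (g * cos \<phi> - sin \<phi>) \<le> 2 * M" by (rule ratio[OF c])
  next
    fix \<phi> :: real assume \<phi>: "\<beta> \<le> \<bar>\<phi>\<bar>" "\<bar>\<phi>\<bar> \<le> pi - \<beta>"
    define \<psi> where "\<psi> = \<bar>\<phi>\<bar>"
    have \<psi>: "sin \<psi> = \<bar>sin \<phi>\<bar>" "cos \<psi> = cos \<phi>" "sin \<psi> > 0"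
    proof -
      show pos: "sin \<psi> > 0" unfolding \<psi>_def using \<phi> ab by (intro sin_gt_zero) linarith+
      show "sin \<psi> = \<bar>sin \<phi>\<bar>" using pos unfolding \<psi>_def by (cases "\<phi> \<ge> 0") auto
      show "cos \<psi> = cos \<phi>" unfolding \<psi>_def by (cases "\<phi> \<ge> 0") auto
    qed
    have "0 \<le> sin (\<psi> - \<beta>)" "0 \<le> sin (\<psi> + \<beta>)"
      using \<phi> ab pi_gt_zero unfolding \<psi>_def by (intro sin_ge_zero; linarith)+
    hence "cos \<beta> * (q\<^sup>2 * cos \<psi>) \<le> cos \<beta> * sin \<psi>" "cos \<beta> * (q\<^sup>2 * - cos \<psi>) \<le> cos \<beta> * sin \<psi>"
      by (simp_all add: sin_add sin_diff sa algebra_simps)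
    hence "q\<^sup>2 * cos \<psi> \<le> sin \<psi>" "q\<^sup>2 * - cos \<psi> \<le> sin \<psi>"
      using cab(2) by (metis mult_le_cancel_left_pos)+
    hence sq: "q\<^sup>2 * \<bar>cos \<phi>\<bar> \<le> \<bar>sin \<phi>\<bar>" unfolding \<psi> by (cases "cos \<phi> \<ge> 0") simp_all
    have ne: "\<bar>sin \<phi>\<bar> > 0" using \<psi> by simp
    \<comment> \<open>Here s / c = g^2 / tan \<phi>, the reflected tangent, which falls into the
      range of the first arc. The sign of sin \<phi> is moved to s because c must be
      positive.\<close>
    define c s where "c = \<bar>sin \<phi>\<bar> / g" and "s = sgn (sin \<phi>) * (g * cos \<phi>)"
    have c: "c > 0" "g * c = \<bar>sin \<phi>\<bar>" using ne g by (auto simp: c_def)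
    have abs_s: "\<bar>s\<bar> = g * \<bar>cos \<phi>\<bar>" using ne g by (auto simp: s_def abs_mult abs_sgn_eq)
    have "(2 * M + 1) * \<bar>s\<bar> = (2 * M + 1) * g * \<bar>cos \<phi>\<bar>" unfolding abs_s by simp
    also have "\<dots> \<le> (2 * M - 1) * q\<^sup>2 * \<bar>cos \<phi>\<bar>" using k2 by (intro mult_right_mono) auto
    also have "\<dots> = (2 * M - 1) * (q\<^sup>2 * \<bar>cos \<phi>\<bar>)" by simp
    also have "\<dots> \<le> (2 * M - 1) * (g * c)"
      unfolding c(2) using sq M(2) by (intro mult_left_mono) auto
    finally have r: "g * c - s \<noteq> 0 \<and> 1 / (2 * M) \<le> (g * c + s) / (g * c - s) \<and>
        (g * c + s) / (g * c - s) \<le> 2 * M"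
      by (rule ratio[OF c(1)])
    have e: "g * c - s = sgn (sin \<phi>) * - (g * cos \<phi> - sin \<phi>)" "g * c + s =
        sgn (sin \<phi>) * (g * cos \<phi> + sin \<phi>)"
      unfolding c(2) s_def by (simp_all add: abs_sgn algebra_simps)
    have "(g * c + s) / (g * c - s) = - ((g * cos \<phi> + sin \<phi>) / (g * cos \<phi> - sin \<phi>))"
      unfolding e using ne
      by (subst mult_divide_mult_cancel_left) (simp_all add: sgn_eq_0_iff del: minus_diff_eq)
    with r e show "g * cos \<phi> - sin \<phi> \<noteq> 0 \<and>
       1 / (2 * M) \<le> - ((g * cos \<phi> + sin \<phi>) / (g * cos \<phi> - sin \<phi>)) \<and>
       - ((g * cos \<phi> + sin \<phi>) / (g * cos \<phi> - sin \<phi>)) \<le> 2 * M" by auto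
  qed
qed

text \<open>A Moebius map multiplies a difference of nodes by one factor for each node. Passing to
  the images therefore only scales rows and columns of the displacement equation, which does not
  increase the rank of its right-hand side.\<close>

lemma moebius_difference:
  fixes g \<theta> \<theta>' c :: real
  assumes d: "g * cos (\<theta> - c) - sin (\<theta> - c) \<noteq> 0" "g * cos (\<theta>' - c) - sin (\<theta>' - c) \<noteq> 0"
  shows "complex_of_real ((g * cos (\<theta> - c) + sin (\<theta> - c)) / (g * cos (\<theta> - c) - sin (\<theta> - c)) -
           (g * cos (\<theta>' - c) + sin (\<theta>' - c)) / (g * cos (\<theta>' - c) - sin (\<theta>' - c))) =
     (- \<i> * of_real g * cis (- \<theta>) / of_real (g * cos (\<theta> - c) - sin (\<theta> - c))) *
     (cis (- \<theta>') / of_real (g * cos (\<theta>' - c) - sin (\<theta>' - c))) * (cis (2 * \<theta>) - cis (2 * \<theta>'))"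
proof -
  define d1 d2 where "d1 = g * cos (\<theta> - c) - sin (\<theta> - c)" and "d2 = g * cos (\<theta>' - c) - sin (\<theta>' - c)"
  have nz: "d1 \<noteq> 0" "d2 \<noteq> 0" using d by (auto simp: d1_def d2_def)
  have s: "sin (\<theta> - \<theta>') = sin (\<theta> - c) * cos (\<theta>' - c) - cos (\<theta> - c) * sin (\<theta>' - c)"
    using sin_diff[of "\<theta> - c" "\<theta>' - c"] by simp
  have "(g * cos (\<theta> - c) + sin (\<theta> - c)) / d1 - (g * cos (\<theta>' - c) + sin (\<theta>' - c)) / d2 =
     ((g * cos (\<theta> - c) + sin (\<theta> - c)) * d2 - (g * cos (\<theta>' - c) + sin (\<theta>' - c)) * d1) / (d1 * d2)"
    using nz by (simp add: divide_simps)
  also have "(g * cos (\<theta> - c) + sin (\<theta> - c)) * d2 - (g * cos (\<theta>' - c) + sin (\<theta>' - c)) * d1 =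
      2 * g * sin (\<theta> - \<theta>')"
    unfolding s d1_def d2_def by (simp add: algebra_simps)
  finally have l: "(g * cos (\<theta> - c) + sin (\<theta> - c)) / d1 - (g * cos (\<theta>' - c) + sin (\<theta>' - c)) / d2 =
     2 * g * sin (\<theta> - \<theta>') / (d1 * d2)" .
  have "cis (- \<theta>) * cis (- \<theta>') * (cis (2 * \<theta>) - cis (2 * \<theta>')) = cis (\<theta> - \<theta>') - cis (\<theta>' - \<theta>)"
    by (simp add: right_diff_distrib cis_mult)
  also have "\<dots> = 2 * \<i> * of_real (sin (\<theta> - \<theta>'))"
    using cos_minus[of "\<theta> - \<theta>'"] sin_minus[of "\<theta> - \<theta>'"] by (simp add: complex_eq_iff)
  finally have r: "cis (- \<theta>) * cis (- \<theta>') * (cis (2 * \<theta>) - cis (2 * \<theta>')) =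
      2 * \<i> * of_real (sin (\<theta> - \<theta>'))" .
  have "(- \<i> * of_real g * cis (- \<theta>) / of_real d1) * (cis (- \<theta>') / of_real d2) * (cis (2 * \<theta>) -
      cis (2 * \<theta>')) =
    - \<i> * of_real g / (of_real d1 * of_real d2) * (cis (- \<theta>) * cis (- \<theta>') * (cis (2 * \<theta>) - cis (2 *
        \<theta>')))"
    by simp
  also have "\<dots> = of_real (g / (d1 * d2)) * (- \<i> * (2 * \<i> * of_real (sin (\<theta> - \<theta>'))))"
    unfolding r by simp
  also have "- \<i> * (2 * \<i> * of_real (sin (\<theta> - \<theta>'))) = of_real (2 * sin (\<theta> - \<theta>'))"
    by (simp add: complex_eq_iff)
  also have "of_real (g / (d1 * d2)) * of_real (2 * sin (\<theta> - \<theta>')) =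
      (of_real (2 * g * sin (\<theta> - \<theta>') / (d1 * d2)) :: complex)"
    unfolding of_real_mult[symmetric] by (simp add: mult_ac)
  finally show ?thesis unfolding d1_def[symmetric] d2_def[symmetric] l by (rule sym)
qed

section \<open>Singular values\<close>

lemma mat_adjoint_dim [simp]:
  "dim_row (mat_adjoint A) = dim_col A" "dim_col (mat_adjoint A) = dim_row A"
  by (simp_all add: mat_adjoint_def)

lemma mat_adjoint_carrier [simp]: "A \<in> carrier_mat n m \<Longrightarrow> mat_adjoint A \<in> carrier_mat m n"
  by (rule carrier_matI) auto

lemma mat_adjoint_index [simp]:
  "i < dim_col A \<Longrightarrow> j < dim_row A \<Longrightarrow> mat_adjoint A $$ (i, j) = conjugate (A $$ (j, i))"
  by (simp add: mat_adjoint_def mat_of_rows_index)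

lemma mat_adjoint_adjoint [simp]: "mat_adjoint (mat_adjoint A) = A"
  by (rule eq_matI) auto

lemma mat_adjoint_mult:
  fixes A B :: "complex mat"
  assumes "A \<in> carrier_mat n m" "B \<in> carrier_mat m k"
  shows "mat_adjoint (A * B) = mat_adjoint B * mat_adjoint A"
proof (rule eq_matI)
  fix i j assume ij: "i < dim_row (mat_adjoint B * mat_adjoint A)" "j <
      dim_col (mat_adjoint B * mat_adjoint A)"
  have "mat_adjoint (A * B) $$ (i, j) = cnj (\<Sum>l<m. A $$ (j, l) * B $$ (l, i))"
    using ij assms by (simp add: scalar_prod_def atLeast0LessThan)
  also have "\<dots> = (\<Sum>l<m. cnj (B $$ (l, i)) * cnj (A $$ (j, l)))" by (simp add: mult.commute)
  also have "\<dots> = (mat_adjoint B * mat_adjoint A) $$ (i, j)"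
    using ij assms by (simp add: scalar_prod_def atLeast0LessThan)
  finally show "mat_adjoint (A * B) $$ (i, j) = (mat_adjoint B * mat_adjoint A) $$ (i, j)" .
qed (use assms in auto)

lemma mult_vec_cscalar:
  fixes A :: "complex mat"
  assumes A: "A \<in> carrier_mat n m" and v: "v \<in> carrier_vec m" and w: "w \<in> carrier_vec n"
  shows "(A *\<^sub>v v) \<bullet>c w = v \<bullet>c (mat_adjoint A *\<^sub>v w)"
proof -
  have "(A *\<^sub>v v) \<bullet>c w = (\<Sum>i<n. (\<Sum>j<m. A $$ (i,j) * v $ j) * cnj (w $ i))"
    using A v w by (simp add: scalar_prod_def atLeast0LessThan)
  also have "\<dots> = (\<Sum>i<n. \<Sum>j<m. A $$ (i,j) * v $ j * cnj (w $ i))"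
    by (simp only: sum_distrib_right)
  also have "\<dots> = (\<Sum>j<m. \<Sum>i<n. A $$ (i,j) * v $ j * cnj (w $ i))" by (rule sum.swap)
  also have "\<dots> = (\<Sum>j<m. \<Sum>i<n. v $ j * cnj (cnj (A $$ (i,j)) * w $ i))"
    by (intro sum.cong refl) simp
  also have "\<dots> = (\<Sum>j<m. v $ j * cnj (\<Sum>i<n. cnj (A $$ (i,j)) * w $ i))"
    by (simp only: sum_distrib_left cnj_sum)
  also have "\<dots> = v \<bullet>c (mat_adjoint A *\<^sub>v w)"
    using A v w by (simp add: scalar_prod_def atLeast0LessThan)
  finally show ?thesis .
qed

section \<open>Unitary diagonalisation of Hermitian matrices\<close>

lemma orthonormal_completion:
  fixes v :: "complex vec"
  assumes v: "v \<in> carrier_vec n" and v0: "v \<noteq> 0\<^sub>v n"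
  obtains W c where "W \<in> carrier_mat n n" "mat_adjoint W * W = 1\<^sub>m n" "col W 0 = c \<cdot>\<^sub>v v"
proof -
  interpret cof_vec_space n "TYPE(complex)" .
  define b where "b = basis_completion v"
  define ws where "ws = gram_schmidt n b"
  from basis_completion[OF v v0, folded b_def]
  have dist_b: "distinct b" and indep: "\<not> lin_dep (set b)" and b: "set b \<subseteq> carrier_vec n"
    and hdb: "hd b = v" and len_b: "length b = n" by auto
  have n: "n > 0" using v v0 by (cases n) auto
  obtain vs where bv: "b = v # vs" using hdb len_b n by (cases b) auto
  have ws: "set ws \<subseteq> carrier_vec n" "corthogonal ws" "length ws = n"
    using gram_schmidt_result[OF b dist_b indep refl, folded ws_def] len_b by auto
  have hdws: "ws ! 0 = v"
    using gram_schmidt_hd[OF v, of vs, folded bv] ws n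
      unfolding ws_def by (metis hd_conv_nth length_greater_0_conv)
  \<comment> \<open>\<open>gram_schmidt\<close> gives an orthogonal family that is not normalised.
    It keeps its first vector, so after scaling the first column is still a multiple of v.\<close>
  define u where "u i = complex_of_real (1 / sqrt (Re (ws ! i \<bullet>c ws ! i))) \<cdot>\<^sub>v ws ! i" for i
  define W where "W = mat_of_cols n (map u [0..<n])"
  have wsc: "ws ! i \<in> carrier_vec n" if "i < n" for i using ws that by auto
  have W: "W \<in> carrier_mat n n" unfolding W_def by auto
  have colW: "col W i = u i" if "i < n" for i
    unfolding W_def using that wsc[OF that] by (subst col_mat_of_cols) (auto simp: u_def)
  have "mat_adjoint W * W = 1\<^sub>m n"
  proof (rule eq_matI)
    fix i j assume "i < dim_row (1\<^sub>m n :: complex mat)" "j < dim_col (1\<^sub>m n :: complex mat)"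
    hence ij: "i < n" "j < n" by auto
    note wi = wsc[OF ij(1)] and wj = wsc[OF ij(2)]
    have r: "row (mat_adjoint W) i = conjugate (u i)"
      by (rule eq_vecI) (use ij W colW[OF ij(1), symmetric] in auto)
    have "(mat_adjoint W * W) $$ (i, j) = conjugate (u i) \<bullet> u j"
      using ij W colW[OF ij(2)] r by simp
    also have "\<dots> = u j \<bullet>c u i"
      by (rule comm_scalar_prod[of _ n]) (use wi wj in \<open>auto simp: u_def\<close>)
    also have "\<dots> = complex_of_real (1 / sqrt (Re (ws ! j \<bullet>c ws ! j))) * (complex_of_real (1 /
        sqrt (Re (ws ! i \<bullet>c ws ! i))) * (ws ! j \<bullet>c ws ! i))"
      unfolding u_def using wi wj by (simp add: conjugate_smult_vec)
    also have "\<dots> = (if i = j then 1 else 0)"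
    proof (cases "i = j")
      case False
      hence "ws ! j \<bullet>c ws ! i = 0" using corthogonalD[OF ws(2), of j i] ij ws(3) by auto
      thus ?thesis using False by simp
    next
      case True
      define z where "z = ws ! i \<bullet>c ws ! i"
      have "z \<ge> 0" "z \<noteq> 0" using corthogonalD[OF ws(2), of i i] ij ws(3) wi by (auto simp: z_def)
      hence z: "z = complex_of_real (Re z)" "Re z > 0"
        by (auto simp: less_eq_complex_def complex_eq_iff less_le)
      have "complex_of_real (1 / sqrt (Re z)) * (complex_of_real (1 / sqrt (Re z)) * z) =
          complex_of_real (1 / sqrt (Re z) * (1 / sqrt (Re z) * Re z))"
        by (subst (3) z(1)) (simp only: of_real_mult)
      also have "1 / sqrt (Re z) * (1 / sqrt (Re z) * Re z) = 1"
        using z(2) by (simp add: field_simps)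
      finally show ?thesis unfolding True[symmetric] z_def by (simp only: of_real_1 if_True refl)
    qed
    finally show "(mat_adjoint W * W) $$ (i, j) = 1\<^sub>m n $$ (i, j)" using ij by simp
  qed (use W in auto)
  thus ?thesis using that[of W] W colW[OF n] unfolding u_def hdws by blast
qed

text \<open>Deflation by one eigenvector at a time. The order of the diagonal is that of the given
  factorisation of the characteristic polynomial, so a sorted list of eigenvalues can be
  prescribed.\<close>

theorem hermitian_spectral:
  fixes A :: "complex mat"
  assumes "A \<in> carrier_mat n n" "mat_adjoint A = A" "char_poly A = (\<Prod>e\<leftarrow>es. [:- e, 1:])"
  shows "\<exists>U \<in> carrier_mat n n. mat_adjoint U * U = 1\<^sub>m n \<and> A * U = U * mat_diag n (\<lambda>i. es ! i)"
  using assms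
proof (induction es arbitrary: n A)
  case Nil
  with degree_monic_char_poly[of A n] have "n = 0" by auto
  with Nil show ?case by (intro bexI[of _ "1\<^sub>m 0"]) (auto intro!: eq_matI simp: mat_diag_def)
next
  case (Cons e es)
  note A = Cons.prems(1) and herm = Cons.prems(2) and cp = Cons.prems(3)
  have mon: "monic (\<Prod>e\<leftarrow>es. [:- e, 1:])" by (rule monic_prod_list) auto
  have "degree (char_poly A) = Suc (degree (\<Prod>e\<leftarrow>es. [:- e, 1:]))"
    unfolding cp list.map prod_list.Cons by (subst degree_mult_eq) (use mon in auto)
  then obtain m where n: "n = Suc m" using degree_monic_char_poly[OF A] by auto
  have "eigenvalue A e" unfolding eigenvalue_root_char_poly[OF A] cp by simp
  then obtain v where "eigenvector A v e" unfolding eigenvalue_def by auto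
  hence v: "v \<in> carrier_vec n" "v \<noteq> 0\<^sub>v n" "A *\<^sub>v v = e \<cdot>\<^sub>v v"
    using A unfolding eigenvector_def by auto
  obtain W c where W: "W \<in> carrier_mat n n" "mat_adjoint W * W = 1\<^sub>m n" "col W 0 = c \<cdot>\<^sub>v v"
    using orthonormal_completion[OF v(1,2)] .
  define W' where "W' = mat_adjoint W"
  have W': "W' \<in> carrier_mat n n" "W' * W = 1\<^sub>m n" using W by (auto simp: W'_def)
  have WW': "W * W' = 1\<^sub>m n" using mat_mult_left_right_inverse[OF W'(1) W(1) W'(2)] .
  define A' where "A' = W' * A * W"
  have A': "A' \<in> carrier_mat n n" using A W W' by (auto simp: A'_def)
  have hA': "mat_adjoint A' = A'"
  proof -
    have "mat_adjoint A' = mat_adjoint W * mat_adjoint (W' * A)" unfolding A'_def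
      by (rule mat_adjoint_mult) (use A W W' in auto)
    also have "mat_adjoint (W' * A) = A * W"
      using mat_adjoint_mult[OF W'(1) A] by (simp add: herm W'_def)
    finally show ?thesis unfolding A'_def W'_def[symmetric] using A W W' by simp
  qed
  have colA': "A' $$ (i, 0) = (if i = 0 then e else 0)" if i: "i < n" for i
  proof -
    have "col (A * W) 0 = A *\<^sub>v (c \<cdot>\<^sub>v v)" using A W n by (subst col_mult2) auto
    also have "\<dots> = e \<cdot>\<^sub>v col W 0"
      unfolding W(3) using A v by (simp add: mult_mat_vec smult_smult_assoc mult.commute)
    finally have c0: "col (A * W) 0 = e \<cdot>\<^sub>v col W 0" .
    have "A' = W' * (A * W)" unfolding A'_def using A W W' by simp
    hence "A' $$ (i, 0) = row W' i \<bullet> col (A * W) 0" using i n A W W' by simp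
    also have "\<dots> = e * (row W' i \<bullet> col W 0)" unfolding c0
      by (rule scalar_prod_smult_distrib[of _ n]) (use i n W(1) W'(1) col_dim[of W 0] in auto)
    also have "row W' i \<bullet> col W 0 = (W' * W) $$ (i, 0)" using i n W(1) W'(1) by simp
    finally show ?thesis unfolding W'(2) using i n by simp
  qed
  \<comment> \<open>The first column of the conjugated matrix is e times a unit vector; being
    Hermitian, the matrix has the same shape in its first row and splits into diagonal
    blocks.\<close>
  have rowA': "A' $$ (0, j) = (if j = 0 then e else 0)" if j: "j < n" for j
  proof (cases "j = 0")
    case False
    have "A' $$ (0, j) = mat_adjoint A' $$ (0, j)" by (simp add: hA')
    also have "\<dots> = 0" using A' j n colA'[OF j] False by simp
    finally show ?thesis using False by simp
  qed (use colA' n in auto)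
  define A3 where "A3 = mat m m (\<lambda>(i, j). A' $$ (Suc i, Suc j))"
  have A3: "A3 \<in> carrier_mat m m" by (simp add: A3_def)
  define blk where "blk x B = four_block_mat (mat 1 1 (\<lambda>_. x)) (0\<^sub>m 1 m) (0\<^sub>m m 1) B"
      for x :: complex and B
  have blk: "blk x B \<in> carrier_mat n n" if "B \<in> carrier_mat m m" for x B
    using that by (auto simp: blk_def n)
  have blk_mult: "blk x B * blk y B' = blk (x * y) (B * B')"
      if "B \<in> carrier_mat m m" "B' \<in> carrier_mat m m" for x y B B'
    unfolding blk_def using that
    by (subst mult_four_block_mat)
        (auto intro!: arg_cong2[where f = "\<lambda>a b. four_block_mat a (0\<^sub>m 1 m) (0\<^sub>m m 1) b"] eq_matI
        simp: scalar_prod_def)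
  have A'blk: "A' = blk e A3"
  proof (rule eq_matI)
    fix i j assume "i < dim_row (blk e A3)" "j < dim_col (blk e A3)"
    hence ij: "i < n" "j < n" using carrier_matD[OF blk[OF A3, of e]] by simp_all
    show "A' $$ (i, j) = blk e A3 $$ (i, j)"
      using ij colA'[OF ij(1)] rowA'[OF ij(2)] n A3
        by (cases i; cases j) (auto simp: blk_def A3_def)
  qed (use A' carrier_matD[OF blk[OF A3, of e]] in auto)
  have hA3: "mat_adjoint A3 = A3"
  proof (rule eq_matI)
    fix i j assume "i < dim_row A3" "j < dim_col A3"
    hence ij: "i < m" "j < m" by (auto simp: A3_def)
    have "A' $$ (Suc i, Suc j) = mat_adjoint A' $$ (Suc i, Suc j)" by (simp add: hA')
    thus "mat_adjoint A3 $$ (i, j) = A3 $$ (i, j)" using ij A' n by (simp add: A3_def)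
  qed (auto simp: A3_def)
  have "similar_mat A' A"
    unfolding similar_mat_def
      by (intro exI[of _ W'] exI[of _ W] similar_mat_witI[of _ _ n])
        (use A A' W W' WW' A'_def in auto)
  from char_poly_similar[OF this] have "char_poly A' = [:- e, 1:] * (\<Prod>e\<leftarrow>es. [:- e, 1:])"
    unfolding cp by (simp only: list.map prod_list.Cons)
  moreover have "char_poly A' = char_poly (mat 1 1 (\<lambda>_. e)) * char_poly A3"
    unfolding A'blk blk_def by (rule char_poly_four_block_zeros_col) (use A3 in auto)
  moreover have "char_poly (mat 1 1 (\<lambda>_. e)) = [:- e, 1:]"
    by (simp add: char_poly_defs det_def sign_def)
  ultimately have "char_poly A3 = (\<Prod>e\<leftarrow>es. [:- e, 1:])"
    by (metis mult_cancel_left pCons_eq_0_iff zero_neq_one)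
  from Cons.IH[OF A3 hA3 this] obtain U where U: "U \<in> carrier_mat m m" "mat_adjoint U * U = 1\<^sub>m m"
    "A3 * U = U * mat_diag m (\<lambda>i. es ! i)" by auto
  define V where "V = blk 1 U"
  have V: "V \<in> carrier_mat n n" unfolding V_def by (rule blk[OF U(1)])
  have aV: "mat_adjoint V = blk 1 (mat_adjoint U)"
    by (rule eq_matI) (use U(1) in \<open>auto simp: V_def blk_def\<close>)
  have one: "blk 1 (1\<^sub>m m) = 1\<^sub>m n"
    unfolding blk_def n by (rule eq_matI) auto
  have diag: "blk e (mat_diag m (\<lambda>i. es ! i)) = mat_diag n (\<lambda>i. (e # es) ! i)"
    unfolding blk_def n by (rule eq_matI) (auto simp: mat_diag_def nth_Cons')
  have VV: "mat_adjoint V * V = 1\<^sub>m n"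
    unfolding aV unfolding V_def using U by (subst blk_mult) (auto simp: one)
  have A'V: "A' * V = V * mat_diag n (\<lambda>i. (e # es) ! i)"
    unfolding A'blk V_def diag[symmetric] using U A3 by (subst blk_mult; simp add: mat_diag_dim)+
  show ?case
  proof (intro bexI conjI)
    show WV: "W * V \<in> carrier_mat n n" using W V by simp
    have "mat_adjoint (W * V) * (W * V) = mat_adjoint V * (W' * (W * V))"
      unfolding mat_adjoint_mult[OF W(1) V] W'_def
        using W V by (simp add: assoc_mult_mat[of _ n n _ n _ n])
    also have "W' * (W * V) = V"
      using W' W V by (simp add: assoc_mult_mat[of _ n n _ n _ n, symmetric])
    finally show "mat_adjoint (W * V) * (W * V) = 1\<^sub>m n" by (simp add: VV)
    have "W * A' = (W * W') * (A * W)"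
      unfolding A'_def using A W W' by (simp add: assoc_mult_mat[of _ n n _ n _ n])
    hence WA': "A * W = W * A'" using A W by (simp add: WW')
    have "A * (W * V) = (A * W) * V" using A W V by (simp add: assoc_mult_mat[of _ n n _ n _ n])
    also have "\<dots> = W * (A' * V)"
      unfolding WA' using W A' V by (simp add: assoc_mult_mat[of _ n n _ n _ n])
    also have "\<dots> = W * V * mat_diag n (\<lambda>i. (e # es) ! i)" unfolding A'V using W V
      by (simp add: assoc_mult_mat[of _ n n _ n _ n] mat_diag_dim)
    finally show "A * (W * V) = W * V * mat_diag n (\<lambda>i. (e # es) ! i)" .
  qed
qed

section \<open>Singular values through norms\<close>

definition vnorm2 :: "complex vec \<Rightarrow> real" where
  "vnorm2 v = (\<Sum>i<dim_vec v. (cmod (v $ i))\<^sup>2)"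

lemma vnorm2_nonneg: "vnorm2 v \<ge> 0" by (simp add: vnorm2_def sum_nonneg)

lemma cscalar_self: "v \<bullet>c v = complex_of_real (vnorm2 v)"
  by (simp add: vnorm2_def scalar_prod_def atLeast0LessThan complex_norm_square[symmetric] flip:
      of_real_power)

lemma vnorm2_isometry:
  assumes "U \<in> carrier_mat n m" "mat_adjoint U * U = 1\<^sub>m m" "w \<in> carrier_vec m"
  shows "vnorm2 (U *\<^sub>v w) = vnorm2 w"
proof -
  have "(U *\<^sub>v w) \<bullet>c (U *\<^sub>v w) = w \<bullet>c (mat_adjoint U *\<^sub>v (U *\<^sub>v w))"
    by (rule mult_vec_cscalar) (use assms in auto)
  also have "mat_adjoint U *\<^sub>v (U *\<^sub>v w) = w"
    using assms by (simp add: assoc_mult_mat_vec[of _ m n _ m, symmetric])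
  finally show ?thesis unfolding cscalar_self by simp
qed

text \<open>Diagonalising the Gram matrix of X yields the right singular vectors U. The norm
  identity for X U w stands in for the left singular vectors and carries all later
  estimates.\<close>

lemma singular_value_decomposition:
  fixes X :: "complex mat"
  assumes X: "X \<in> carrier_mat nr nc"
  obtains U where "U \<in> carrier_mat nc nc" "mat_adjoint U * U = 1\<^sub>m nc"
    "length (singular_value_list X) = nc"
    "\<And>w. w \<in> carrier_vec nc \<Longrightarrow>
      vnorm2 (X *\<^sub>v (U *\<^sub>v w)) = (\<Sum>i<nc. (singular_value_list X ! i)\<^sup>2 * (cmod (w $ i))\<^sup>2)"
    "\<And>i j. i \<le> j \<Longrightarrow> j < nc \<Longrightarrow> singular_value_list X ! j \<le> singular_value_list X ! i"
    "\<And>i. i < nc \<Longrightarrow> 0 \<le> singular_value_list X ! i"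
proof -
  define A where "A = mat_adjoint X * X"
  have A: "A \<in> carrier_mat nc nc" using X by (auto simp: A_def)
  have hA: "mat_adjoint A = A"
    unfolding A_def using mat_adjoint_mult[of "mat_adjoint X" nc nr X nc] X by simp
  define f where "f z = sqrt (Re z)" for z
  obtain es0 where es0: "char_poly A = (\<Prod>e\<leftarrow>es0. [:- e, 1:])" "length es0 = nc"
    using char_poly_factorized[OF A] by auto
  \<comment> \<open>Sorting by the square root of the real part, then reversing, matches the order
    used in \<open>singular_value_list\<close>.\<close>
  define es where "es = rev (sort_key f es0)"
  have cp: "char_poly A = (\<Prod>e\<leftarrow>es. [:- e, 1:])"
    unfolding es0 es_def by (simp flip: prod_mset_prod_list)
  have len: "length es = nc" using es0 by (simp add: es_def)
  have pr: "proots (char_poly A) = mset es0"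
  proof -
    have "proots (\<Prod>p\<leftarrow>map (\<lambda>e. [:- e, 1:]) es0. p) = (\<Sum>p\<leftarrow>map (\<lambda>e. [:- e, 1:]) es0. proots p)"
      by (rule proots_prod_list) auto
    also have "\<dots> = mset es0" by (induction es0) auto
    finally show ?thesis by (simp add: es0)
  qed
  have srt: "sort (map f es0) = map f (sort_key f es0)" by (rule properties_for_sort) auto
  have sv: "singular_value_list X = map f es"
    unfolding singular_value_list_def A_def[symmetric] es_def pr
    by (simp add: f_def[abs_def, symmetric] rev_map srt flip: mset_map)
  obtain U where U: "U \<in> carrier_mat nc nc" "mat_adjoint U * U = 1\<^sub>m nc" "A * U =
      U * mat_diag nc (\<lambda>i. es ! i)"
    using hermitian_spectral[OF A hA cp] by auto
  have norm: "complex_of_real (vnorm2 (X *\<^sub>v (U *\<^sub>v w))) =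
      (\<Sum>i<nc. cnj (es ! i) * complex_of_real ((cmod (w $ i))\<^sup>2))"
    if w: "w \<in> carrier_vec nc" for w
  proof -
    let ?D = "mat_diag nc (\<lambda>i. es ! i)"
    have D: "?D \<in> carrier_mat nc nc" by (simp add: mat_diag_dim)
    have Dw: "?D *\<^sub>v w = vec nc (\<lambda>i. es ! i * w $ i)"
      using w
        by (intro eq_vecI)
          (auto simp: mat_diag_def scalar_prod_def if_distrib if_distribR sum.delta cong: if_cong)
    have "complex_of_real (vnorm2 (X *\<^sub>v (U *\<^sub>v w))) = (X *\<^sub>v (U *\<^sub>v w)) \<bullet>c (X *\<^sub>v (U *\<^sub>v w))"
      by (simp add: cscalar_self)
    also have "\<dots> = (U *\<^sub>v w) \<bullet>c (mat_adjoint X *\<^sub>v (X *\<^sub>v (U *\<^sub>v w)))"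
      by (rule mult_vec_cscalar[OF X]) (use U X w in auto)
    also have "mat_adjoint X *\<^sub>v (X *\<^sub>v (U *\<^sub>v w)) = (A * U) *\<^sub>v w"
      unfolding assoc_mult_mat_vec[OF A U(1) w] unfolding A_def
      by (rule assoc_mult_mat_vec[of _ nc nr _ nc, symmetric]) (use X U(1) w in auto)
    also have "\<dots> = U *\<^sub>v (?D *\<^sub>v w)"
      unfolding U(3) using U D w by (simp add: assoc_mult_mat_vec[of _ nc nc _ nc])
    also have "(U *\<^sub>v w) \<bullet>c (U *\<^sub>v (?D *\<^sub>v w)) = w \<bullet>c (mat_adjoint U *\<^sub>v (U *\<^sub>v (?D *\<^sub>v w)))"
      by (rule mult_vec_cscalar[OF U(1) w])
          (use U(1) D w in \<open>auto intro!: mult_mat_vec_carrier[of _ nc nc]\<close>)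
    also have "mat_adjoint U *\<^sub>v (U *\<^sub>v (?D *\<^sub>v w)) = ?D *\<^sub>v w"
    proof -
      have y: "?D *\<^sub>v w \<in> carrier_vec nc" using D w by (rule mult_mat_vec_carrier)
      have "mat_adjoint U *\<^sub>v (U *\<^sub>v (?D *\<^sub>v w)) = (mat_adjoint U * U) *\<^sub>v (?D *\<^sub>v w)"
        by (rule assoc_mult_mat_vec[of _ nc nc _ nc, symmetric]) (use U(1) y in auto)
      thus ?thesis using y by (simp add: U(2))
    qed
    also have "w \<bullet>c (?D *\<^sub>v w) = (\<Sum>i<nc. cnj (es ! i) * complex_of_real ((cmod (w $ i))\<^sup>2))"
    proof -
      have "w \<bullet>c (?D *\<^sub>v w) = (\<Sum>i<nc. w $ i * cnj (es ! i * w $ i))"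
        unfolding Dw using w by (simp add: scalar_prod_def atLeast0LessThan)
      also have "\<dots> = (\<Sum>i<nc. cnj (es ! i) * complex_of_real ((cmod (w $ i))\<^sup>2))"
        unfolding complex_norm_square by (intro sum.cong refl) simp
      finally show ?thesis .
    qed
    finally show ?thesis .
  qed
  \<comment> \<open>The conjugates in \<open>norm\<close> are there because the eigenvalues are not
    yet known to be real. Unit vectors w turn each conjugate into a squared norm, which settles
    reality and sign together.\<close>
  have ev: "es ! i = complex_of_real (Re (es ! i)) \<and> Re (es ! i) \<ge> 0" if i: "i < nc" for i
  proof -
    have "complex_of_real (vnorm2 (X *\<^sub>v (U *\<^sub>v unit_vec nc i))) = (\<Sum>j<nc. if j =
        i then cnj (es ! i) else 0)"
      unfolding norm[OF unit_vec_carrier] using i by (intro sum.cong) auto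
    also have "\<dots> = cnj (es ! i)" using i by simp
    finally have "cnj (es ! i) = complex_of_real (vnorm2 (X *\<^sub>v (U *\<^sub>v unit_vec nc i)))" ..
    hence "es ! i = complex_of_real (vnorm2 (X *\<^sub>v (U *\<^sub>v unit_vec nc i)))"
      using complex_cnj_cnj[of "es ! i"] by simp
    thus ?thesis by (simp add: vnorm2_nonneg)
  qed
  show ?thesis
  proof (rule that[OF U(1,2)])
    show "length (singular_value_list X) = nc" by (simp add: sv len)
    fix w :: "complex vec" assume w: "w \<in> carrier_vec nc"
    have "complex_of_real (vnorm2 (X *\<^sub>v (U *\<^sub>v w))) =
        (\<Sum>i<nc. complex_of_real ((f (es ! i))\<^sup>2 * (cmod (w $ i))\<^sup>2))"
      unfolding norm[OF w]
    proof (intro sum.cong refl)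
      fix i assume "i \<in> {..<nc}"
      hence e: "es ! i = complex_of_real (Re (es ! i))" "Re (es ! i) \<ge> 0" using ev by auto
      have "cnj (es ! i) = complex_of_real (Re (es ! i))" by (subst e(1)) simp
      thus "cnj (es ! i) * complex_of_real ((cmod (w $ i))\<^sup>2) =
          complex_of_real ((f (es ! i))\<^sup>2 * (cmod (w $ i))\<^sup>2)"
        using e(2) by (simp add: f_def)
    qed
    also have "\<dots> = complex_of_real (\<Sum>i<nc. (singular_value_list X ! i)\<^sup>2 * (cmod (w $ i))\<^sup>2)"
      unfolding sv of_real_sum by (intro sum.cong refl) (simp add: len)
    finally show "vnorm2 (X *\<^sub>v (U *\<^sub>v w)) =
        (\<Sum>i<nc. (singular_value_list X ! i)\<^sup>2 * (cmod (w $ i))\<^sup>2)"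
      by (simp only: of_real_eq_iff)
  next
    fix i j assume ij: "i \<le> j" "j < nc"
    have "sorted (rev (singular_value_list X))" unfolding singular_value_list_def by simp
    thus "singular_value_list X ! j \<le> singular_value_list X ! i"
      using ij by (intro sorted_rev_nth_mono) (auto simp: sv len)
  next
    fix i assume "i < nc"
    thus "0 \<le> singular_value_list X ! i" using ev[of i] by (simp add: sv len f_def)
  qed
qed

section \<open>Rank factorisation and the singular value estimate\<close>

text \<open>Padding with a zero row makes the system square. The transpose annihilates the last unit
  vector, so the determinant vanishes.\<close>

lemma homogeneous_system_nontrivial:
  fixes B :: "nat \<Rightarrow> nat \<Rightarrow> complex"
  shows "\<exists>w \<in> carrier_vec (Suc r). w \<noteq> 0\<^sub>v (Suc r) \<and> (\<forall>l<r. (\<Sum>i<Suc r. B l i * w $ i) = 0)"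
proof -
  define M where "M = mat (Suc r) (Suc r) (\<lambda>(l, i). if l < r then B l i else 0)"
  have M: "M \<in> carrier_mat (Suc r) (Suc r)" by (simp add: M_def)
  have "det M = 0"
  proof -
    have "transpose_mat M *\<^sub>v unit_vec (Suc r) r = 0\<^sub>v (Suc r)"
      by (rule eq_vecI) (simp_all add: M_def scalar_prod_right_unit)
    moreover have "unit_vec (Suc r) r \<noteq> (0\<^sub>v (Suc r) :: complex vec)"
      by (rule unit_vec_nonzero) simp
    moreover have "transpose_mat M \<in> carrier_mat (Suc r) (Suc r)" using M by simp
    ultimately have "det (transpose_mat M) = 0"
      using det_0_iff_vec_prod_zero_field[of "transpose_mat M" "Suc r"] unit_vec_carrier by blast
    thus ?thesis using det_transpose[OF M] by simp
  qed
  then obtain w where w: "w \<in> carrier_vec (Suc r)" "w \<noteq> 0\<^sub>v (Suc r)" "M *\<^sub>v w = 0\<^sub>v (Suc r)"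
    using det_0_iff_vec_prod_zero_field[OF M] by auto
  have "(\<Sum>i<Suc r. B l i * w $ i) = 0" if l: "l < r" for l
  proof -
    have "(M *\<^sub>v w) $ l = (\<Sum>i<Suc r. B l i * w $ i)"
      using l w(1) by (simp add: M_def scalar_prod_def atLeast0LessThan lessThan_Suc)
    thus ?thesis using w(3) l by simp
  qed
  thus ?thesis using w by blast
qed

text \<open>Expand every column in a maximal independent set of columns; coefficients beyond its
  cardinality are set to 0, so that exactly \<rho> terms appear.\<close>

lemma rank_factorization:
  fixes W :: "complex mat"
  assumes W: "W \<in> carrier_mat n nc" and rank: "vec_space.rank n W \<le> \<rho>"
  obtains a b :: "nat \<Rightarrow> nat \<Rightarrow> complex"
  where "\<And>i j. i < n \<Longrightarrow> j < nc \<Longrightarrow> W $$ (i, j) = (\<Sum>l<\<rho>. a l i * b l j)"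
proof -
  interpret cof_vec_space n "TYPE(complex)" .
  have cols: "set (cols W) \<subseteq> carrier_vec n" using cols_dim[of W] W by auto
  let ?P = "\<lambda>T. T \<subseteq> set (cols W) \<and> lin_indpt T"
  have "?P {}" using finite_lin_indpt2[of "{}"] by auto
  then obtain S where S: "finite S" "maximal S ?P"
    using maximal_exists_superset[of "set (cols W)" ?P "{}"] by auto
  have PS: "?P S" using S(2) unfolding maximal_def by blast
  have Sc: "S \<subseteq> carrier_vec n" using PS cols by auto
  have card: "card S \<le> \<rho>" using rank rank_card_indpt[OF W S(2)] by simp
  have span: "c \<in> span S" if c: "c \<in> set (cols W)" for c
  proof (rule ccontr)
    assume n: "c \<notin> span S"
    hence cS: "c \<notin> S" using span_mem[OF Sc] by auto
    have "lin_indpt (S \<union> {c})" using lin_dep_iff_in_span[OF Sc _ _ cS] PS n c cols by auto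
    hence "?P (S \<union> {c})" using PS c by auto
    hence "S \<union> {c} = S" using S(2) unfolding maximal_def by blast
    thus False using cS by auto
  qed
  obtain e where e: "bij_betw e {..<card S} S"
    using ex_bij_betw_nat_finite[OF S(1)] by (auto simp: atLeast0LessThan)
  have "\<exists>co. \<forall>i<n. W $$ (i, j) = (\<Sum>x\<in>S. co x * x $ i)" if j: "j < nc" for j
  proof -
    have "col W j \<in> span S" using span[of "col W j"] j W by (auto simp: cols_def)
    then obtain co where "col W j = lincomb co S" using finite_span[OF S(1)] Sc by auto
    hence "W $$ (i, j) = (\<Sum>x\<in>S. co x * x $ i)" if "i < n" for i
      using lincomb_index[OF that Sc, of co] that j W by (metis carrier_matD index_col)
    thus ?thesis by blast
  qed
  then obtain co where co: "\<And>i j. i < n \<Longrightarrow> j < nc \<Longrightarrow> W $$ (i, j) = (\<Sum>x\<in>S. co j x * x $ i)" by metis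
  have "W $$ (i, j) = (\<Sum>l<\<rho>. (e l $ i) * (if l < card S then co j (e l) else 0))" if ij: "i <
      n" "j < nc" for i j
  proof -
    have "W $$ (i, j) = (\<Sum>l<card S. co j (e l) * e l $ i)"
      unfolding co[OF ij] by (rule sum.reindex_bij_betw[OF e, symmetric])
    also have "\<dots> = (\<Sum>l<card S. (e l $ i) * (if l < card S then co j (e l) else 0))"
      by (simp add: mult.commute)
    also have "\<dots> = (\<Sum>l<\<rho>. (e l $ i) * (if l < card S then co j (e l) else 0))"
      using card by (intro sum.mono_neutral_left) auto
    finally show ?thesis .
  qed
  thus ?thesis by (rule that[of "\<lambda>l i. e l $ i" "\<lambda>l j. if l < card S then co j (e l) else 0"])
qed

lemma vnorm2_vec_le:
  assumes "\<And>i. i < N \<Longrightarrow> cmod (\<alpha> i) \<le> \<eta>"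
  shows "vnorm2 (vec N (\<lambda>i. \<alpha> i * f i)) \<le> \<eta>\<^sup>2 * vnorm2 (vec N f)"
proof -
  have "vnorm2 (vec N (\<lambda>i. \<alpha> i * f i)) = (\<Sum>i<N. (cmod (\<alpha> i))\<^sup>2 * (cmod (f i))\<^sup>2)"
    by (simp add: vnorm2_def norm_mult power_mult_distrib)
  also have "\<dots> \<le> (\<Sum>i<N. \<eta>\<^sup>2 * (cmod (f i))\<^sup>2)"
    using assms by (intro sum_mono mult_right_mono power_mono) auto
  also have "\<dots> = \<eta>\<^sup>2 * vnorm2 (vec N f)" by (simp add: vnorm2_def sum_distrib_left)
  finally show ?thesis .
qed

lemma vnorm2_pos:
  assumes "v \<in> carrier_vec N" "v \<noteq> 0\<^sub>v N" shows "vnorm2 v > 0"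
proof -
  obtain i where i: "i < N" "v $ i \<noteq> 0" using assms by (metis carrier_vecD eq_vecI index_zero_vec)
  have "0 < (cmod (v $ i))\<^sup>2" using i by simp
  also have "\<dots> \<le> vnorm2 v" unfolding vnorm2_def using i assms
    by (intro member_le_sum) auto
  finally show ?thesis .
qed

text \<open>An Eckart-Young argument for an approximation given implicitly. Among the combinations
  of the first r + 1 right singular vectors some nonzero v is annihilated by all r functionals b l.
  On it X acts as diag \<alpha> X diag \<beta>, so |X v| <= \<eta>^2 \<sigma>_1 |v|, whereas |X v|
  >= \<sigma>_(r+1) |v|.\<close>

lemma singular_value_le:
  fixes X :: "complex mat" and a b :: "nat \<Rightarrow> nat \<Rightarrow> complex"
  assumes X: "X \<in> carrier_mat nr nc" and nonempty: "nr > 0" "nc > 0"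
    and low: "\<And>i j. i < nr \<Longrightarrow> j < nc \<Longrightarrow> X $$ (i, j) * (1 - \<alpha> i * \<beta> j) = (\<Sum>l<r. a l i * b l j)"
    and \<alpha>: "\<And>i. i < nr \<Longrightarrow> cmod (\<alpha> i) \<le> \<eta>" and \<beta>: "\<And>j. j < nc \<Longrightarrow> cmod (\<beta> j) \<le> \<eta>"
  shows "singular_value X (r + 1) \<le> \<eta>\<^sup>2 * spectral_norm X"
proof -
  obtain U where U: "U \<in> carrier_mat nc nc" "mat_adjoint U * U = 1\<^sub>m nc"
    and len: "length (singular_value_list X) = nc"
    and nrm: "\<And>w. w \<in> carrier_vec nc \<Longrightarrow>
      vnorm2 (X *\<^sub>v (U *\<^sub>v w)) = (\<Sum>i<nc. (singular_value_list X ! i)\<^sup>2 * (cmod (w $ i))\<^sup>2)"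
    and dec: "\<And>i j. i \<le> j \<Longrightarrow> j < nc \<Longrightarrow> singular_value_list X ! j \<le> singular_value_list X ! i"
    and nonneg: "\<And>i. i < nc \<Longrightarrow> 0 \<le> singular_value_list X ! i"
    using singular_value_decomposition[OF X] by blast
  define \<sigma> where "\<sigma> i = singular_value_list X ! i" for i
  have sp: "spectral_norm X = \<sigma> 0"
    using X nonempty by (simp add: spectral_norm_def singular_value_def \<sigma>_def)
  have s0: "\<sigma> 0 \<ge> 0" using nonneg nonempty by (simp add: \<sigma>_def)
  show ?thesis
  proof (cases "r < min nr nc")
    \<comment> \<open>Beyond the smaller dimension \<open>singular_value\<close> is 0 by
      definition.\<close>
    case False
    thus ?thesis using X s0 by (auto simp: singular_value_def sp)
  next
    case True
    have sr: "singular_value X (r + 1) = \<sigma> r" using True X by (simp add: singular_value_def \<sigma>_def)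
    have r: "r < nc" using True by simp
    have UU: "U * mat_adjoint U = 1\<^sub>m nc"
      by (rule mat_mult_left_right_inverse[OF _ U(1) U(2)]) (use U in auto)
    have upper: "vnorm2 (X *\<^sub>v y) \<le> (\<sigma> 0)\<^sup>2 * vnorm2 y" if y: "y \<in> carrier_vec nc" for y
    proof -
      define z where "z = mat_adjoint U *\<^sub>v y"
      have z: "z \<in> carrier_vec nc"
        using U(1) y unfolding z_def by (intro mult_mat_vec_carrier[of _ nc nc]) auto
      have "U *\<^sub>v z = (U * mat_adjoint U) *\<^sub>v y"
        unfolding z_def by (rule assoc_mult_mat_vec[symmetric, of _ nc nc _ nc]) (use U y in auto)
      hence Uz: "U *\<^sub>v z = y" using y by (simp add: UU)
      have "vnorm2 (X *\<^sub>v y) = (\<Sum>i<nc. (\<sigma> i)\<^sup>2 * (cmod (z $ i))\<^sup>2)"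
        using nrm[OF z] unfolding Uz \<sigma>_def .
      also have "\<dots> \<le> (\<Sum>i<nc. (\<sigma> 0)\<^sup>2 * (cmod (z $ i))\<^sup>2)"
        using dec nonneg unfolding \<sigma>_def by (intro sum_mono mult_right_mono power_mono) auto
      also have "\<dots> = (\<sigma> 0)\<^sup>2 * vnorm2 z" using z by (simp add: vnorm2_def sum_distrib_left)
      also have "vnorm2 z = vnorm2 y" using vnorm2_isometry[OF U z] Uz by simp
      finally show ?thesis .
    qed
    obtain w0 where w0: "w0 \<in> carrier_vec (Suc r)" "w0 \<noteq> 0\<^sub>v (Suc r)"
      "\<forall>l<r. (\<Sum>i<Suc r. (\<Sum>j<nc. b l j * U $$ (j, i)) * w0 $ i) = 0"
      using homogeneous_system_nontrivial[of r "\<lambda>l i. \<Sum>j<nc. b l j * U $$ (j, i)"] by blast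
    \<comment> \<open>Padding with zeros restricts the coordinates to the leading r + 1 singular
      directions, where each singular value is at least the entry at list position r.\<close>
    define w where "w = vec nc (\<lambda>i. if i < Suc r then w0 $ i else 0)"
    have w: "w \<in> carrier_vec nc" by (simp add: w_def)
    have "w \<noteq> 0\<^sub>v nc"
    proof
      assume w0v: "w = 0\<^sub>v nc"
      have "w0 $ i = 0" if i: "i < Suc r" for i
      proof -
        have "w0 $ i = w $ i" using i r by (simp add: w_def)
        also have "\<dots> = 0" unfolding w0v using i r by simp
        finally show ?thesis .
      qed
      hence "w0 = 0\<^sub>v (Suc r)" using w0(1) by (intro eq_vecI) auto
      thus False using w0(2) by simp
    qed
    hence wpos: "vnorm2 w > 0" using vnorm2_pos[OF w] by simp
    define v where "v = U *\<^sub>v w"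
    have v: "v \<in> carrier_vec nc"
      unfolding v_def using U(1) w by (intro mult_mat_vec_carrier[of _ nc nc])
    have vj: "v $ j = (\<Sum>i<Suc r. U $$ (j, i) * w0 $ i)" if j: "j < nc" for j
    proof -
      have "v $ j = (\<Sum>i<nc. U $$ (j, i) * (if i < Suc r then w0 $ i else 0))"
        using j U(1) by (simp add: v_def w_def scalar_prod_def atLeast0LessThan)
      also have "\<dots> = (\<Sum>i<Suc r. U $$ (j, i) * (if i < Suc r then w0 $ i else 0))"
        using r by (intro sum.mono_neutral_right) auto
      finally show ?thesis by simp
    qed
    have ortho: "(\<Sum>j<nc. b l j * v $ j) = 0" if l: "l < r" for l
    proof -
      have "(\<Sum>j<nc. b l j * v $ j) = (\<Sum>j<nc. \<Sum>i<Suc r. b l j * U $$ (j, i) * w0 $ i)"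
        by (intro sum.cong refl) (simp only: vj lessThan_iff sum_distrib_left mult.assoc)
      also have "\<dots> = (\<Sum>i<Suc r. \<Sum>j<nc. b l j * U $$ (j, i) * w0 $ i)" by (rule sum.swap)
      also have "\<dots> = (\<Sum>i<Suc r. (\<Sum>j<nc. b l j * U $$ (j, i)) * w0 $ i)"
        by (simp only: sum_distrib_right)
      finally show ?thesis using w0(3) l by simp
    qed
    define y where "y = vec nc (\<lambda>j. \<beta> j * v $ j)"
    have y: "y \<in> carrier_vec nc" by (simp add: y_def)
    have Xv: "X *\<^sub>v v = vec nr (\<lambda>i. \<alpha> i * (X *\<^sub>v y) $ i)"
    proof (rule eq_vecI)
      fix i assume "i < dim_vec (vec nr (\<lambda>i. \<alpha> i * (X *\<^sub>v y) $ i))"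
      hence i: "i < nr" by simp
      have "(X *\<^sub>v v) $ i = (\<Sum>j<nc. X $$ (i, j) * v $ j)"
        using i X v by (simp add: scalar_prod_def atLeast0LessThan)
      also have "\<dots> = (\<Sum>j<nc. \<alpha> i * (X $$ (i, j) * (\<beta> j * v $ j)) + (\<Sum>l<r. a l i * b l j) * v $ j)"
        by (intro sum.cong refl) (simp add: low[OF i, symmetric] algebra_simps)
      also have "\<dots> = \<alpha> i * (\<Sum>j<nc. X $$ (i, j) * (\<beta> j * v $ j)) + (\<Sum>j<nc. (\<Sum>l<r. a l i * b l j) *
          v $ j)"
        by (simp only: sum.distrib sum_distrib_left)
      also have "(\<Sum>j<nc. X $$ (i, j) * (\<beta> j * v $ j)) = (X *\<^sub>v y) $ i"
        using i X y by (simp add: scalar_prod_def atLeast0LessThan y_def)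
      also have "(\<Sum>j<nc. (\<Sum>l<r. a l i * b l j) * v $ j) = (\<Sum>l<r. a l i * (\<Sum>j<nc. b l j * v $ j))"
        unfolding sum_distrib_right sum_distrib_left by (subst sum.swap) (simp only: mult.assoc)
      also have "\<dots> = 0" using ortho by simp
      finally show "(X *\<^sub>v v) $ i = vec nr (\<lambda>i. \<alpha> i * (X *\<^sub>v y) $ i) $ i" using i by simp
    qed (use X in auto)
    have "(\<sigma> r)\<^sup>2 * vnorm2 w = (\<Sum>i<nc. (\<sigma> r)\<^sup>2 * (cmod (w $ i))\<^sup>2)"
      using w by (simp add: vnorm2_def sum_distrib_left)
    also have "\<dots> \<le> (\<Sum>i<nc. (\<sigma> i)\<^sup>2 * (cmod (w $ i))\<^sup>2)"
    proof (rule sum_mono)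
      fix i assume "i \<in> {..<nc}"
      thus "(\<sigma> r)\<^sup>2 * (cmod (w $ i))\<^sup>2 \<le> (\<sigma> i)\<^sup>2 * (cmod (w $ i))\<^sup>2"
        using dec[of i r] nonneg[OF r] r unfolding \<sigma>_def
        by (cases "i < Suc r") (auto simp: w_def intro!: mult_right_mono power_mono)
    qed
    also have "\<dots> = vnorm2 (X *\<^sub>v v)" unfolding v_def \<sigma>_def nrm[OF w] ..
    also have "\<dots> \<le> \<eta>\<^sup>2 * vnorm2 (vec nr (\<lambda>i. (X *\<^sub>v y) $ i))"
      unfolding Xv by (rule vnorm2_vec_le[OF \<alpha>])
    also have "vec nr (\<lambda>i. (X *\<^sub>v y) $ i) = X *\<^sub>v y" using X by (intro eq_vecI) auto
    also have "\<eta>\<^sup>2 * vnorm2 (X *\<^sub>v y) \<le> \<eta>\<^sup>2 * ((\<sigma> 0)\<^sup>2 * (\<eta>\<^sup>2 * vnorm2 v))"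
    proof (intro mult_left_mono order.trans[OF upper[OF y]])
      have "vnorm2 y \<le> \<eta>\<^sup>2 * vnorm2 (vec nc (\<lambda>j. v $ j))"
        unfolding y_def by (rule vnorm2_vec_le[OF \<beta>])
      also have "vec nc (\<lambda>j. v $ j) = v" using v by (intro eq_vecI) auto
      finally show "vnorm2 y \<le> \<eta>\<^sup>2 * vnorm2 v" .
    qed auto
    also have "vnorm2 v = vnorm2 w" unfolding v_def by (rule vnorm2_isometry[OF U w])
    also have "\<eta>\<^sup>2 * ((\<sigma> 0)\<^sup>2 * (\<eta>\<^sup>2 * vnorm2 w)) = (\<eta>\<^sup>2 * \<sigma> 0)\<^sup>2 * vnorm2 w"
      by (simp add: power2_eq_square)
    finally have "(\<sigma> r)\<^sup>2 \<le> (\<eta>\<^sup>2 * \<sigma> 0)\<^sup>2" using wpos by simp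
    hence "\<sigma> r \<le> \<eta>\<^sup>2 * \<sigma> 0" by (rule power2_le_imp_le) (use s0 in auto)
    thus ?thesis unfolding sr sp .
  qed
qed

section \<open>Low rank from a displacement equation\<close>

lemma sum_sum_div_mod:
  fixes f :: "nat \<Rightarrow> nat \<Rightarrow> 'a::comm_monoid_add"
  shows "(\<Sum>s<k. \<Sum>l<\<rho>. f s l) = (\<Sum>m<\<rho> * k. f (m div \<rho>) (m mod \<rho>))"
proof -
  have "(\<Sum>s<k. \<Sum>l<\<rho>. f s l) = (\<Sum>(s,l)\<in>{..<k} \<times> {..<\<rho>}. f s l)" by (rule sum.cartesian_product)
  also have "\<dots> = (\<Sum>m<\<rho> * k. f (m div \<rho>) (m mod \<rho>))"
  proof (rule sum.reindex_bij_witness[where i = "\<lambda>m. (m div \<rho>, m mod \<rho>)" and j = "\<lambda>(s,l). l + \<rho> *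
      s"])
    fix x assume "x \<in> {..<k} \<times> {..<\<rho>}"
    then obtain s l where x: "x = (s, l)" "s < k" "l < \<rho>" by auto
    have "l + \<rho> * s < \<rho> * Suc s" using x by simp
    also have "\<dots> \<le> \<rho> * k" using x by (intro mult_left_mono) auto
    finally show "(case x of (s, l) \<Rightarrow> l + \<rho> * s) \<in> {..<\<rho> * k}" using x by simp
    show "f ((case x of (s, l) \<Rightarrow> l + \<rho> * s) div \<rho>) ((case x of (s, l) \<Rightarrow> l + \<rho> * s) mod \<rho>) =
        (case x of (s, l) \<Rightarrow> f s l)"
      using x by simp
    show "((case x of (s, l) \<Rightarrow> l + \<rho> * s) div \<rho>, (case x of (s, l) \<Rightarrow> l + \<rho> * s) mod \<rho>) = x"
      using x by simp
  next
    fix m assume m: "m \<in> {..<\<rho> * k}"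
    hence "\<rho> > 0" by (cases \<rho>) auto
    thus "(m div \<rho>, m mod \<rho>) \<in> {..<k} \<times> {..<\<rho>}"
      using m by (auto simp: less_mult_imp_div_less mult.commute)
  qed auto
  finally show ?thesis .
qed

lemma one_minus_prod:
  fixes B :: "nat \<Rightarrow> 'a::comm_ring_1"
  shows "1 - (\<Prod>s<k. B s) = (\<Sum>s<k. (1 - B s) * (\<Prod>t<s. B t))"
  by (induction k) (simp_all add: algebra_simps)

text \<open>One minus a product of k factors telescopes into k terms, and each contains some 1 - p
  q, which is divisible by \<xi> - \<zeta>. That divisor times the entry of X is the displacement,
  of rank at most \<rho>; everything else splits into a row factor and a column factor.\<close>

lemma displacement_low_rank:
  fixes X :: "complex mat" and \<xi> \<zeta> y :: "nat \<Rightarrow> complex"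
  assumes disp: "\<And>i j. i < nr \<Longrightarrow> j < nc \<Longrightarrow> (\<xi> i - \<zeta> j) * X $$ (i, j) = (\<Sum>l<\<rho>. a l i * b l j)"
    and \<xi>: "\<And>i s. i < nr \<Longrightarrow> \<xi> i - y s \<noteq> 0" and \<zeta>: "\<And>j s. j < nc \<Longrightarrow> \<zeta> j + y s \<noteq> 0"
  shows "\<exists>a' b'. \<forall>i<nr. \<forall>j<nc.
     X $$ (i, j) * (1 - (\<Prod>s<k. (\<xi> i + y s) / (\<xi> i - y s)) * (\<Prod>s<k. (\<zeta> j - y s) / (\<zeta> j + y s))) =
     (\<Sum>l<\<rho> * k. a' l i * b' l j)"
proof -
  define p q where "p i s = (\<xi> i + y s) / (\<xi> i - y s)" and "q j s =
      (\<zeta> j - y s) / (\<zeta> j + y s)" for i j s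
  define a' where "a' m i = a (m mod \<rho>) i / (\<xi> i - y (m div \<rho>)) * (\<Prod>t<m div \<rho>. p i t)" for m i
  define b' where "b' m j = 2 * y (m div \<rho>) * b (m mod \<rho>) j / (\<zeta> j + y (m div \<rho>)) *
      (\<Prod>t<m div \<rho>. q j t)" for m j
  have "X $$ (i, j) * (1 - (\<Prod>s<k. p i s) * (\<Prod>s<k. q j s)) = (\<Sum>l<\<rho> * k. a' l i * b' l j)"
    if ij: "i < nr" "j < nc" for i j
  proof -
    have step: "1 - p i s * q j s = 2 * y s * (\<xi> i - \<zeta> j) / ((\<xi> i - y s) * (\<zeta> j + y s))" for s
      unfolding p_def q_def
        using \<xi>[OF ij(1), of s] \<zeta>[OF ij(2), of s]
        by (simp add: divide_simps) (simp add: algebra_simps)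
    have "X $$ (i, j) * (1 - (\<Prod>s<k. p i s) * (\<Prod>s<k. q j s)) =
        (\<Sum>s<k. X $$ (i, j) * ((1 - p i s * q j s) * (\<Prod>t<s. p i t * q j t)))"
      unfolding prod.distrib[symmetric] one_minus_prod sum_distrib_left ..
    also have "\<dots> = (\<Sum>s<k. (\<xi> i - \<zeta> j) * X $$ (i, j) * (2 * y s / ((\<xi> i - y s) * (\<zeta> j + y s)) *
        ((\<Prod>t<s. p i t) * (\<Prod>t<s. q j t))))"
      unfolding step prod.distrib by (intro sum.cong refl) simp
    also have "\<dots> = (\<Sum>s<k. \<Sum>l<\<rho>. (a l i / (\<xi> i - y s) * (\<Prod>t<s. p i t)) * (2 * y s * b l j / (\<zeta> j +
        y s) * (\<Prod>t<s. q j t)))"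
      unfolding disp[OF ij] sum_distrib_right by (intro sum.cong refl) simp
    also have "\<dots> = (\<Sum>m<\<rho> * k. a' m i * b' m j)"
      unfolding sum_sum_div_mod a'_def b'_def ..
    finally show ?thesis .
  qed
  thus ?thesis unfolding p_def q_def by blast
qed

section \<open>Submatrices of the displaced matrix\<close>

text \<open>The half-angles pi j / n are measured from the midpoint of K. With d the spread of K,
  those of K lie within d/2 steps, and those of J at least d/2 + sep steps away in both directions
  around the circle. If d > 0, the ratio (\<alpha> + \<beta>) / (\<beta> - \<alpha>) is (d + sep) /
  sep <= M, and n >= 2 (m + sep - 1) gives \<alpha> + \<beta> <= pi/2.\<close>

lemma m_sep_moebius:
  fixes n m sep :: nat
  assumes sep: "sep \<ge> 1" and m: "m \<ge> 2" and n: "n \<ge> 2 * (m + sep - 1)"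
    and \<omega>: "\<omega> = exp (\<i> * of_real pi / of_nat n)" and JK: "m_sep_indices n m sep J K"
    and M_def: "M = (real m + real sep - 1) / real sep"
  obtains x :: "nat \<Rightarrow> real" and f h :: "nat \<Rightarrow> complex" where
    "\<And>j. j \<in> J \<Longrightarrow> 1 / (2 * M) \<le> - x j \<and> - x j \<le> 2 * M"
    "\<And>k. k \<in> K \<Longrightarrow> 1 / (2 * M) \<le> x k \<and> x k \<le> 2 * M"
    "\<And>j k. j \<in> J \<Longrightarrow> k \<in> K \<Longrightarrow>
       complex_of_real (x j) - complex_of_real (x k) = f j * h k * (\<omega> ^ (2 * j) - \<omega> ^ (2 * k))"
proof -
  note I = JK[unfolded m_sep_indices_def]
  have fK: "finite K" using I by (meson finite_atLeastLessThan finite_subset)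
  have K0: "K \<noteq> {}" using I by auto
  define k0 k1 where "k0 = Min K" and "k1 = Max K"
  have k01: "k0 \<in> K" "k1 \<in> K" "\<And>k. k \<in> K \<Longrightarrow> k0 \<le> k \<and> k \<le> k1"
    using fK K0 by (auto simp: k0_def k1_def)
  define d where "d = real k1 - real k0"
  have d: "0 \<le> d" "d \<le> real m - 1"
  proof -
    show "0 \<le> d" using k01 by (auto simp: d_def)
    have "\<bar>int k1 - int k0\<bar> \<le> int m - 1" using I k01 by blast
    thus "d \<le> real m - 1" unfolding d_def by linarith
  qed
  have "k1 = k0 \<or> k0 + 1 \<le> k1" using k01(3)[OF k01(2)] by linarith
  hence d1: "d = 0 \<or> d \<ge> 1" unfolding d_def by auto
  have n2: "2 * (m + sep) \<le> n + 2" "n > 0" using n m sep by auto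
  have "real (2 * (m + sep)) \<le> real (n + 2)" using n2(1) by (simp only: of_nat_le_iff)
  hence n': "real n \<ge> 2 * (real m + real sep - 1)" by simp
  have npos: "real n > 0" using n2(2) by simp
  have s1: "real sep \<ge> 1" using sep by simp
  have m2: "real m \<ge> 2" using m by simp
  \<comment> \<open>If \<open>K\<close> is a single index, its arc degenerates to a point and is widened a little.\<close>
  define hw where "hw = (if d = 0 then 1 / 4 else d / 2)"
  have hw: "hw > 0" "d / 2 \<le> hw" "hw < d / 2 + real sep" "hw + d / 2 + real sep \<le> real n / 2"
    using d d1 s1 m2 n' by (auto simp: hw_def)
  have M1: "M \<ge> 1" using s1 m2 by (simp add: M_def)
  \<comment> \<open>For d = 0 the widened arc is paid for by m >= 2: then M >= 1 + 1/sep, which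
    exceeds the quotient (sep + 1/4) / (sep - 1/4).\<close>
  have hwM: "hw + (d / 2 + real sep) \<le> M * (d / 2 + real sep - hw)"
  proof (cases "d = 0")
    case False
    hence "hw + (d / 2 + real sep) = d + real sep" "d / 2 + real sep - hw = real sep"
      by (simp_all add: hw_def)
    moreover have "M * real sep = real m + real sep - 1" using s1 by (simp add: M_def)
    ultimately show ?thesis using d by simp
  next
    case True
    have "M \<ge> 1 + 1 / real sep" using s1 m2 by (simp add: M_def field_simps)
    hence "(1 + 1 / real sep) * (real sep - 1 / 4) \<le> M * (real sep - 1 / 4)"
      using s1 by (intro mult_right_mono) auto
    moreover have "real sep + 1 / 4 \<le> (1 + 1 / real sep) * (real sep - 1 / 4)"
      using s1 by (simp add: field_simps)
    ultimately show ?thesis using True by (simp add: hw_def)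
  qed
  define \<alpha> \<beta> where "\<alpha> = pi * hw / real n" and "\<beta> = pi * (d / 2 + real sep) / real n"
  have scale: "pi * u / real n \<le> pi * v / real n \<longleftrightarrow> u \<le> v" "pi * u / real n < pi * v / real n \<longleftrightarrow> u <
      v" for u v
    using npos by (simp_all add: divide_le_cancel divide_less_cancel)
  have ab: "0 < \<alpha>" "\<alpha> < \<beta>" "\<alpha> + \<beta> \<le> pi / 2" "\<alpha> + \<beta> \<le> M * (\<beta> - \<alpha>)"
  proof -
    show "0 < \<alpha>" using hw npos by (simp add: \<alpha>_def)
    show "\<alpha> < \<beta>" unfolding \<alpha>_def \<beta>_def scale by (rule hw)
    have "\<alpha> + \<beta> = pi * (hw + d / 2 + real sep) / real n"
      by (simp add: \<alpha>_def \<beta>_def add_divide_distrib distrib_left)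
    also have "\<dots> \<le> pi * (real n / 2) / real n" unfolding scale by (rule hw)
    finally show "\<alpha> + \<beta> \<le> pi / 2" using npos by simp
    have "pi * (hw + (d / 2 + real sep)) / real n \<le> pi * (M * (d / 2 + real sep - hw)) / real n"
      unfolding scale by (rule hwM)
    moreover have "pi * (hw + (d / 2 + real sep)) / real n = \<alpha> + \<beta>"
      by (simp add: \<alpha>_def \<beta>_def add_divide_distrib distrib_left)
    moreover have "pi * (M * (d / 2 + real sep - hw)) / real n = M * (\<beta> - \<alpha>)"
      by (simp add: \<alpha>_def \<beta>_def diff_divide_distrib add_divide_distrib distrib_left
          right_diff_distrib mult_ac)
    ultimately show "\<alpha> + \<beta> \<le> M * (\<beta> - \<alpha>)" by simp
  qed
  obtain g where g: "g > 0"
    and gK: "\<And>\<phi>. \<bar>\<phi>\<bar> \<le> \<alpha> \<Longrightarrow> g * cos \<phi> - sin \<phi> \<noteq> 0 \<and>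
       1 / (2 * M) \<le> (g * cos \<phi> + sin \<phi>) / (g * cos \<phi> - sin \<phi>) \<and>
       (g * cos \<phi> + sin \<phi>) / (g * cos \<phi> - sin \<phi>) \<le> 2 * M"
    and gJ: "\<And>\<phi>. \<beta> \<le> \<bar>\<phi>\<bar> \<Longrightarrow> \<bar>\<phi>\<bar> \<le> pi - \<beta> \<Longrightarrow> g * cos \<phi> - sin \<phi> \<noteq> 0 \<and>
       1 / (2 * M) \<le> - ((g * cos \<phi> + sin \<phi>) / (g * cos \<phi> - sin \<phi>)) \<and>
       - ((g * cos \<phi> + sin \<phi>) / (g * cos \<phi> - sin \<phi>)) \<le> 2 * M"
    using moebius_arcs[OF ab M1] by blast
  define \<theta> where "\<theta> j = pi * real j / real n" for j :: nat
  define mid where "mid = (real k0 + real k1) / 2"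
  define c where "c = pi * mid / real n"
  have \<phi>: "\<bar>\<theta> j - c\<bar> = pi * \<bar>real j - mid\<bar> / real n" for j
  proof -
    have "\<theta> j - c = pi * (real j - mid) / real n"
      by (simp add: \<theta>_def c_def diff_divide_distrib right_diff_distrib)
    thus ?thesis using npos by (simp add: abs_mult)
  qed
  have angK: "\<bar>\<theta> k - c\<bar> \<le> \<alpha>" if k: "k \<in> K" for k
    unfolding \<phi> \<alpha>_def scale
      using k01(3)[OF k] hw(2) unfolding mid_def d_def by (auto simp: abs_le_iff field_simps)
  have angJ: "\<beta> \<le> \<bar>\<theta> j - c\<bar> \<and> \<bar>\<theta> j - c\<bar> \<le> pi - \<beta>" if j: "j \<in> J" for j
  proof -
    have pb: "pi - \<beta> = pi * (real n - (d / 2 + real sep)) / real n"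
      using npos by (simp add: \<beta>_def diff_divide_distrib right_diff_distrib)
    have jn: "j < n" and kn: "k0 < n" "k1 < n" using I j k01 by auto
    have out: "j < k0 \<or> k1 < j" using I j by (auto simp: k0_def k1_def not_le)
    have a: "\<bar>int j - int k0\<bar> \<ge> int sep" "\<bar>int j - int k1\<bar> \<ge> int sep"
      "\<bar>int j - int k0 - int n\<bar> \<ge> int sep" "\<bar>int j - int k1 + int n\<bar> \<ge> int sep"
      using I j k01 by blast+
    have k01': "k0 \<le> k1" using k01 by blast
    \<comment> \<open>The lower bound uses the end of K nearer to j within the row of indices. The
      upper bound uses the other end, reached by going round the circle, where the separation modulo
      n enters.\<close>
    have "d / 2 + real sep \<le> \<bar>real j - mid\<bar> \<and> \<bar>real j - mid\<bar> \<le> real n - (d / 2 + real sep)"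
    proof (cases "k1 < j")
      case True
      have "int j - int k1 \<ge> int sep" "int n - (int j - int k0) \<ge> int sep"
        using a True jn k01' by linarith+
      hence "real j - real k1 \<ge> real sep" "real n - (real j - real k0) \<ge> real sep" by linarith+
      moreover have "real j - mid \<ge> 0" using True k01' by (simp add: mid_def)
      ultimately show ?thesis by (simp add: mid_def d_def field_simps)
    next
      case False
      hence jk: "j < k0" using out by simp
      have "int k0 - int j \<ge> int sep" "int n - (int k1 - int j) \<ge> int sep"
        using a jk kn k01' by linarith+
      hence "real k0 - real j \<ge> real sep" "real n - (real k1 - real j) \<ge> real sep" by linarith+
      moreover have "real j - mid \<le> 0" using jk k01' by (simp add: mid_def)
      ultimately show ?thesis by (simp add: mid_def d_def field_simps)
    qed
    thus ?thesis unfolding pb unfolding \<phi> \<beta>_def scale .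
  qed
  define D where "D j = g * cos (\<theta> j - c) - sin (\<theta> j - c)" for j
  define x where "x j = (g * cos (\<theta> j - c) + sin (\<theta> j - c)) / D j" for j
  have cw: "\<omega> ^ (2 * j) = cis (2 * \<theta> j)" for j
  proof -
    have "\<omega> = cis (pi / real n)" unfolding \<omega> cis_conv_exp by simp
    thus ?thesis by (simp add: Complex.DeMoivre \<theta>_def mult_ac)
  qed
  show ?thesis
  proof (rule that[of x "\<lambda>j. - \<i> * of_real g * cis (- \<theta> j) / of_real (D j)" "\<lambda>k. cis (- \<theta> k) /
      of_real (D k)"])
    show "1 / (2 * M) \<le> - x j \<and> - x j \<le> 2 * M" if "j \<in> J" for j
      using gJ[of "\<theta> j - c"] angJ[OF that] unfolding x_def D_def by blast
    show "1 / (2 * M) \<le> x k \<and> x k \<le> 2 * M" if "k \<in> K" for k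
      using gK[OF angK[OF that]] unfolding x_def D_def by blast
    show "complex_of_real (x j) - complex_of_real (x k) =
      (- \<i> * of_real g * cis (- \<theta> j) / of_real (D j)) * (cis (- \<theta> k) / of_real (D k)) * (\<omega> ^ (2 * j)
          - \<omega> ^ (2 * k))"
      if jk: "j \<in> J" "k \<in> K" for j k
      unfolding cw x_def D_def of_real_diff[symmetric]
      by (rule moebius_difference)
          (use gJ[of "\<theta> j - c"] angJ[OF jk(1)] gK[OF angK[OF jk(2)]] in blast)+
  qed
qed

section \<open>Combination of the estimates\<close>

theorem theorem2p2:
  fixes n m sep \<rho> r :: nat
    and C D G H :: "complex mat"
    and \<omega> :: complex
    and J K :: "nat set"
    and \<epsilon> :: real
  assumes "sep \<ge> 1" and "m \<ge> 2" and "n \<ge> 2 * (m + sep - 1)"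
    and "C \<in> carrier_mat n n" and "G \<in> carrier_mat n r" and "H \<in> carrier_mat n r"
    and "\<omega> = exp (\<i> * of_real pi / of_nat n)"
    and "D = mat_diag n (\<lambda>k. \<omega> ^ (2 * k))"
    and "D * C - C * D = G * mat_adjoint H"
    and "vec_space.rank n (G * mat_adjoint H) \<le> \<rho>"
    and "m_sep_indices n m sep J K"
    and "0 < \<epsilon>" and "\<epsilon> < 1"
  shows "int (eps_rank \<epsilon> (submatrix C J K))
    \<le> int \<rho> * \<lceil>2 / pi\<^sup>2 * ln (4 * ((real m + real sep - 1) / real sep)) * ln (4 / \<epsilon>)\<rceil>"
proof -
  define M where "M = (real m + real sep - 1) / real sep"
  note C = assms(4) and G = assms(5) and H = assms(6)
  have M: "M \<ge> 1" using assms(1,2) by (simp add: M_def)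
  have L: "ln (4 * M) > 0" using M by simp
  have Le: "ln (4 / \<epsilon>) > 0" using assms(12,13) by simp
  define k where "k = nat \<lceil>2 / pi\<^sup>2 * ln (4 * M) * ln (4 / \<epsilon>)\<rceil>"
  have kpos0: "0 < 2 / pi\<^sup>2 * ln (4 * M) * ln (4 / \<epsilon>)" using L Le by simp
  have k: "k > 0" "int k = \<lceil>2 / pi\<^sup>2 * ln (4 * M) * ln (4 / \<epsilon>)\<rceil>"
    "2 / pi\<^sup>2 * ln (4 * M) * ln (4 / \<epsilon>) \<le> real k"
    using kpos0 unfolding k_def by (simp_all add: zero_less_ceiling)
  obtain x f h where xJ: "\<And>j. j \<in> J \<Longrightarrow> 1 / (2 * M) \<le> - x j \<and> - x j \<le> 2 * M"
    and xK: "\<And>k. k \<in> K \<Longrightarrow> 1 / (2 * M) \<le> x k \<and> x k \<le> 2 * M"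
    and xd: "\<And>j k. j \<in> J \<Longrightarrow> k \<in> K \<Longrightarrow>
       complex_of_real (x j) - complex_of_real (x k) = f j * h k * (\<omega> ^ (2 * j) - \<omega> ^ (2 * k))"
    using m_sep_moebius[OF assms(1-3,7,11) M_def] by metis
  define \<eta> where "\<eta> = 2 * exp (- pi\<^sup>2 * real k / (4 * ln (4 * M)))"
  obtain y where y: "\<And>i. y i > 0" and yb: "\<And>x. 1 / (2 * M) \<le> x \<Longrightarrow> x \<le> 2 * M \<Longrightarrow>
       \<bar>\<Prod>i<k. (x - y i) / (x + y i)\<bar> \<le> \<eta>"
    using zolotarev_bound[OF M k(1)] unfolding \<eta>_def by metis
  \<comment> \<open>The ceiling defining k is the least integer for which this holds.\<close>
  have \<eta>2: "\<eta>\<^sup>2 \<le> \<epsilon>"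
  proof -
    have "\<eta>\<^sup>2 = 4 * exp (- (pi\<^sup>2 * real k / (2 * ln (4 * M))))"
      by (simp add: \<eta>_def power2_eq_square mult_exp_exp field_simps)
    also have "\<dots> \<le> 4 * exp (- ln (4 / \<epsilon>))"
    proof -
      have "2 * ln (4 * M) * ln (4 / \<epsilon>) \<le> pi\<^sup>2 * real k"
        using mult_left_mono[OF k(3), of "pi\<^sup>2"] by simp
      hence "ln (4 / \<epsilon>) \<le> pi\<^sup>2 * real k / (2 * ln (4 * M))"
        using L by (simp add: pos_le_divide_eq mult_ac)
      thus ?thesis by simp
    qed
    also have "\<dots> = \<epsilon>" using assms(12) by (simp add: exp_minus)
    finally show ?thesis .
  qed
  have J: "J \<noteq> {}" "J \<subseteq> {0..<n}" and K: "K \<noteq> {}" "K \<subseteq> {0..<n}"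
    using assms(11) unfolding m_sep_indices_def by auto
  have cJ: "{i. i < n \<and> i \<in> J} = J" and cK: "{i. i < n \<and> i \<in> K} = K" using J K by auto
  have fin: "finite J" "finite K" using J K finite_subset by blast+
  define X where "X = submatrix C J K"
  have X: "X \<in> carrier_mat (card J) (card K)"
    unfolding X_def by (rule carrier_matI) (use C in \<open>simp_all add: dim_submatrix cJ cK\<close>)
  have Xij: "X $$ (i, j) = C $$ (pick J i, pick K j)" if "i < card J" "j < card K" for i j
    unfolding X_def using that C by (subst submatrix_index) (auto simp: cJ cK)
  have pJ: "pick J i \<in> J" if "i < card J" for i using that by (rule pick_in_set_le)
  have pK: "pick K i \<in> K" if "i < card K" for i using that by (rule pick_in_set_le)
  have W: "G * mat_adjoint H \<in> carrier_mat n n" using G H by auto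
  obtain a b where ab: "\<And>i j. i < n \<Longrightarrow> j < n \<Longrightarrow> (G * mat_adjoint H) $$ (i, j) = (\<Sum>l<\<rho>. a l i * b l j)"
    using rank_factorization[OF W assms(10)] by metis
  have disp: "(\<omega> ^ (2 * i) - \<omega> ^ (2 * j)) * C $$ (i, j) = (\<Sum>l<\<rho>. a l i * b l j)" if ij: "i < n" "j <
      n" for i j
  proof -
    have "(G * mat_adjoint H) $$ (i, j) = (D * C - C * D) $$ (i, j)" using assms(9) by simp
    also have "\<dots> = (\<omega> ^ (2 * i) - \<omega> ^ (2 * j)) * C $$ (i, j)"
      unfolding assms(8) mat_diag_mult_left[OF C] mat_diag_mult_right[OF C] using ij
      by (simp add: algebra_simps)
    finally show ?thesis using ab[OF ij] by simp
  qed
  let ?\<xi> = "\<lambda>i. complex_of_real (x (pick J i))" and ?\<zeta> = "\<lambda>j. complex_of_real (x (pick K j))"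
    and ?y = "\<lambda>s. complex_of_real (y s)"
  have neg: "x j < 0" if "j \<in> J" for j
  proof -
    have "0 < 1 / (2 * M)" using M by simp
    thus ?thesis using xJ[OF that] by linarith
  qed
  have pos: "x j > 0" if "j \<in> K" for j
  proof -
    have "0 < 1 / (2 * M)" using M by simp
    thus ?thesis using xK[OF that] by linarith
  qed
  have "\<exists>a' b'. \<forall>i<card J. \<forall>j<card K.
     X $$ (i, j) * (1 - (\<Prod>s<k. (?\<xi> i + ?y s) / (?\<xi> i - ?y s)) * (\<Prod>s<k. (?\<zeta> j - ?y s) / (?\<zeta> j + ?y
         s))) =
     (\<Sum>l<\<rho> * k. a' l i * b' l j)"
  proof (rule displacement_low_rank)
    fix i j assume ij: "i < card J" "j < card K"
    have ijn: "pick J i < n" "pick K j < n" using pJ[OF ij(1)] pK[OF ij(2)] J K by auto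
    \<comment> \<open>The factors f and h of the Moebius difference are absorbed into the two sides
      of the rank factorisation.\<close>
    have "(?\<xi> i - ?\<zeta> j) * X $$ (i, j) =
       f (pick J i) * h (pick K j) * ((\<omega> ^ (2 * pick J i) - \<omega> ^ (2 * pick K j)) * C $$ (pick J i,
           pick K j))"
      unfolding xd[OF pJ[OF ij(1)] pK[OF ij(2)]] Xij[OF ij] by simp
    also have "\<dots> = (\<Sum>l<\<rho>. (f (pick J i) * a l (pick J i)) * (h (pick K j) * b l (pick K j)))"
      unfolding disp[OF ijn] sum_distrib_left by (intro sum.cong refl) simp
    finally show "(?\<xi> i - ?\<zeta> j) * X $$ (i, j) =
       (\<Sum>l<\<rho>. (f (pick J i) * a l (pick J i)) * (h (pick K j) * b l (pick K j)))" .
  next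
    fix i s assume "i < card J"
    hence "x (pick J i) - y s \<noteq> 0" using neg[OF pJ] y[of s] by (smt (verit))
    thus "?\<xi> i - ?y s \<noteq> 0" by (metis of_real_diff of_real_eq_0_iff)
  next
    fix j s assume "j < card K"
    hence "x (pick K j) + y s \<noteq> 0" using pos[OF pK] y[of s] by (smt (verit))
    thus "?\<zeta> j + ?y s \<noteq> 0" by (metis of_real_add of_real_eq_0_iff)
  qed
  then obtain a' b' where low: "\<And>i j. i < card J \<Longrightarrow> j < card K \<Longrightarrow>
     X $$ (i, j) * (1 - (\<Prod>s<k. (?\<xi> i + ?y s) / (?\<xi> i - ?y s)) * (\<Prod>s<k. (?\<zeta> j - ?y s) / (?\<zeta> j + ?y
         s))) =
     (\<Sum>l<\<rho> * k. a' l i * b' l j)" by blast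
  have "singular_value X (\<rho> * k + 1) \<le> \<eta>\<^sup>2 * spectral_norm X"
  proof (rule singular_value_le[OF X _ _ low])
    show "card J > 0" "card K > 0" using J K fin by (auto simp: card_gt_0_iff)
    fix i assume i: "i < card J"
    \<comment> \<open>Negating a node of J inverts R, so the row factor 1 / R(x) is R(z) with z in
      the interval where R is small.\<close>
    define z where "z = - x (pick J i)"
    have zb: "1 / (2 * M) \<le> z" "z \<le> 2 * M" using xJ[OF pJ[OF i]] by (auto simp: z_def)
    have "(\<Prod>s<k. (?\<xi> i + ?y s) / (?\<xi> i - ?y s)) = complex_of_real (\<Prod>s<k. (z - y s) / (z + y s))"
      unfolding of_real_prod
    proof (intro prod.cong refl)
      fix s
      have "z - y s = - (x (pick J i) + y s)" "z + y s = - (x (pick J i) - y s)"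
        by (simp_all add: z_def)
      hence "(x (pick J i) + y s) / (x (pick J i) - y s) = (z - y s) / (z + y s)"
        by (simp only: minus_divide_divide)
      thus "(?\<xi> i + ?y s) / (?\<xi> i - ?y s) = complex_of_real ((z - y s) / (z + y s))"
        by (metis of_real_add of_real_diff of_real_divide)
    qed
    thus "cmod (\<Prod>s<k. (?\<xi> i + ?y s) / (?\<xi> i - ?y s)) \<le> \<eta>"
      using yb[OF zb] by (simp only: norm_of_real)
  next
    fix j assume j: "j < card K"
    have "(\<Prod>s<k. (?\<zeta> j - ?y s) / (?\<zeta> j + ?y s)) =
        complex_of_real (\<Prod>s<k. (x (pick K j) - y s) / (x (pick K j) + y s))"
      by simp
    thus "cmod (\<Prod>s<k. (?\<zeta> j - ?y s) / (?\<zeta> j + ?y s)) \<le> \<eta>"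
      using yb xK[OF pK[OF j]] by (simp only: norm_of_real)
  qed
  also have "\<dots> \<le> \<epsilon> * spectral_norm X"
  proof (rule mult_right_mono[OF \<eta>2])
    have "card K > 0" "card J > 0" using J K fin by (auto simp: card_gt_0_iff)
    moreover obtain U where "\<And>i. i < card K \<Longrightarrow> 0 \<le> singular_value_list X ! i"
      using singular_value_decomposition[OF X] by blast
    ultimately show "0 \<le> spectral_norm X" by (simp add: spectral_norm_def singular_value_def)
  qed
  finally have "eps_rank \<epsilon> X \<le> \<rho> * k" unfolding eps_rank_def by (rule Least_le)
  hence "int (eps_rank \<epsilon> X) \<le> int \<rho> * int k" by (metis of_nat_le_iff of_nat_mult)
  thus ?thesis unfolding X_def k(2) M_def .
qed

end
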